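(* Let $d_1,d_2\ge1$, $d=d_1+d_2$, and let $B=(B_x)_{x\in\mathbb{R}^d}$ be a real-valued, continuous, centered, stationary Gaussian field with unit variance, whose covariance function $C:\mathbb{R}^d\to\mathbb{R}$ is additively separable: $$C(x_1,x_2)=K_1(x_1)+K_2(x_2),\qquad x_1\in\mathbb{R}^{d_1},\ x_2\in\mathbb{R}^{d_2},$$ where $K_1,K_2$ are the covariance functions of two stationary, continuous, centered Gaussian fields $(B^{(1)}_{x_1})_{x_1\in\mathbb{R}^{d_1}}$ and $(B^{(2)}_{x_2})_{x_2\in\mathbb{R}^{d_2}}$, with $K_1(0),K_2(0)>0$. Assume $K_1,K_2\ge0$. Let $q\ge1$ be an integer and assume that $$\frac{\gamma^1_{t_1}[q]}{\gamma^2_{t_2}[q]}\to0\qquad\text{as }t_1,t_2\to\infty,\qquad\text{where}\quad \gamma^i_{t_i}[q]:=\frac{\int_{(t_iD_i)^2}K_i^q(x_i-y_i)\,dx_i\,dy_i}{\mathrm{Vol}(t_iD_i)^2}.$$ Then $$\widetilde A_2(t_2)[q]\overset{d}{\to}N(0,1)\quad\text{as }t_2\to\infty$$ if and only if $$\widetilde Y(t_1,t_2)[q]\overset{d}{\to}N(0,1)\quad\text{as }t_1,t_2\to\infty.$$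
   Context: The covariance function $C$ of $B$ is defined by $\mathrm{Cov}(B_x,B_y)=C(x-y)$. $D_1\subseteq\mathbb{R}^{d_1}$ and $D_2\subseteq\mathbb{R}^{d_2}$ are compact sets with $\mathrm{Vol}(D_i)>0$. $H_q$ is the $q$th (probabilists') Hermite polynomial, and $\overset{d}{\to}$ denotes convergence in distribution. Functionals: $$Y(t_1,t_2)[q]=\int_{t_1D_1\times t_2D_2}H_q(B_x)\,dx,\qquad A_i(t_i)[q]=\int_{t_iD_i}H_q\!\left(\frac{B^{(i)}_{x_i}}{\sqrt{K_i(0)}}\right)dx_i\quad(i=1,2),$$ and a tilde denotes standardization: $\widetilde Z=(Z-\mathbb{E}[Z])/\sqrt{\mathrm{Var}(Z)}$. *)

theory Defs
  imports "HOL-Probability.Probability"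
begin

fun hermite :: "nat \<Rightarrow> real \<Rightarrow> real" where
  "hermite 0 x = 1"
| "hermite (Suc 0) x = x"
| "hermite (Suc (Suc n)) x = x * hermite (Suc n) x - real (Suc n) * hermite n x"

lemma hermite_has_derivative:
  "(hermite (Suc n) has_real_derivative real (Suc n) * hermite n x) (at x)"
proof (induction n x rule: hermite.induct)
  case (1 x)
  have "hermite (Suc 0) = (\<lambda>x. x)" by (simp add: fun_eq_iff)
  then show ?case by simp
next
  case (2 x)
  have "hermite (Suc (Suc 0)) = (\<lambda>x. x * x - 1)" by (simp add: fun_eq_iff)
  then show ?case by (auto intro!: derivative_eq_intros)
next
  case (3 n x)
  have "((\<lambda>x. x * hermite (Suc (Suc n)) x - real (Suc (Suc n)) * hermite (Suc n) x)
      has_real_derivative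
      1 * hermite (Suc (Suc n)) x + real (Suc (Suc n)) * hermite (Suc n) x * x
        - real (Suc (Suc n)) * (real (Suc n) * hermite n x)) (at x)"
    by (intro DERIV_diff DERIV_mult DERIV_ident DERIV_cmult 3)
  moreover have "hermite (Suc (Suc (Suc n))) =
      (\<lambda>x. x * hermite (Suc (Suc n)) x - real (Suc (Suc n)) * hermite (Suc n) x)"
    by (simp add: fun_eq_iff)
  ultimately show ?case by (simp add: algebra_simps)
qed

text \<open>Rodrigues' formula: the normalisation is the probabilists' one.\<close>

lemma hermite_rodrigues:
  "(deriv ^^ n) (\<lambda>x. exp (- x\<^sup>2 / 2)) = (\<lambda>x. (-1) ^ n * hermite n x * exp (- x\<^sup>2 / 2))"
proof (induction n)
  case 0
  then show ?case by simp
next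
  case (Suc n)
  have e: "((\<lambda>x::real. exp (- x\<^sup>2 / 2)) has_real_derivative - x * exp (- x\<^sup>2 / 2)) (at x)" for x
    by (auto intro!: derivative_eq_intros)
  have "((\<lambda>x. hermite n x * exp (- x\<^sup>2 / 2))
      has_real_derivative - hermite (Suc n) x * exp (- x\<^sup>2 / 2)) (at x)" for x
  proof (cases n)
    case 0
    then show ?thesis using e by simp
  next
    case (Suc m)
    show ?thesis
      unfolding Suc
      by (rule DERIV_cong[OF DERIV_mult[OF hermite_has_derivative e]])
         (simp add: algebra_simps)
  qed
  then have "((\<lambda>x. (-1) ^ n * (hermite n x * exp (- x\<^sup>2 / 2)))
      has_real_derivative (-1) ^ n * (- hermite (Suc n) x * exp (- x\<^sup>2 / 2))) (at x)" for x
    by (rule DERIV_cmult)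
  then have "deriv (\<lambda>x. (-1) ^ n * (hermite n x * exp (- x\<^sup>2 / 2)))
      = (\<lambda>x. (-1) ^ n * (- hermite (Suc n) x * exp (- x\<^sup>2 / 2)))"
    by (intro ext DERIV_imp_deriv)
  moreover have "(deriv ^^ n) (\<lambda>x. exp (- x\<^sup>2 / 2))
      = (\<lambda>x. (-1) ^ n * (hermite n x * exp (- x\<^sup>2 / 2)))"
    using Suc by (simp add: mult.assoc)
  ultimately have "deriv ((deriv ^^ n) (\<lambda>x. exp (- x\<^sup>2 / 2)))
      = (\<lambda>x. (-1) ^ n * (- hermite (Suc n) x * exp (- x\<^sup>2 / 2)))"
    by simp
  then show ?case by (simp add: mult.assoc)
qed

definition covariance :: "'w measure \<Rightarrow> ('w \<Rightarrow> real) \<Rightarrow> ('w \<Rightarrow> real) \<Rightarrow> real" where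
  "covariance M X Y =
     (\<integral>\<omega>. (X \<omega> - integral\<^sup>L M X) * (Y \<omega> - integral\<^sup>L M Y) \<partial>M)"

definition gaussian_variable :: "'w measure \<Rightarrow> ('w \<Rightarrow> real) \<Rightarrow> bool" where
  "gaussian_variable M X \<longleftrightarrow> X \<in> borel_measurable M \<and>
     (\<exists>\<mu> \<sigma>. (\<sigma> > 0 \<and> distributed M lborel X (normal_density \<mu> \<sigma>)) \<or>
            (AE \<omega> in M. X \<omega> = \<mu>))"

definition gaussian_field :: "'w measure \<Rightarrow> ('x \<Rightarrow> 'w \<Rightarrow> real) \<Rightarrow> bool" where
  "gaussian_field M B \<longleftrightarrow>
     (\<forall>x. B x \<in> borel_measurable M) \<and>
     (\<forall>J a. finite J \<longrightarrow> gaussian_variable M (\<lambda>\<omega>. \<Sum>x\<in>J. a x * B x \<omega>))"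

definition centered_field :: "'w measure \<Rightarrow> ('x \<Rightarrow> 'w \<Rightarrow> real) \<Rightarrow> bool" where
  "centered_field M B \<longleftrightarrow> (\<forall>x. integral\<^sup>L M (B x) = 0)"

definition stationary_field :: "'w measure \<Rightarrow> ('x::ab_group_add \<Rightarrow> 'w \<Rightarrow> real) \<Rightarrow> bool" where
  "stationary_field M B \<longleftrightarrow>
     (\<forall>h J. finite J \<longrightarrow>
        distr M (\<Pi>\<^sub>M x\<in>J. borel) (\<lambda>\<omega>. \<lambda>x\<in>J. B (x + h) \<omega>) =
        distr M (\<Pi>\<^sub>M x\<in>J. borel) (\<lambda>\<omega>. \<lambda>x\<in>J. B x \<omega>))"

text \<open>Every sample path is continuous; in particular the integrals of the paths are measurable.\<close>

definition continuous_field ::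
  "'w measure \<Rightarrow> ('x::topological_space \<Rightarrow> 'w \<Rightarrow> real) \<Rightarrow> bool" where
  "continuous_field M B \<longleftrightarrow> (\<forall>\<omega>\<in>space M. continuous_on UNIV (\<lambda>x. B x \<omega>))"

definition has_covariance_function ::
  "'w measure \<Rightarrow> ('x::ab_group_add \<Rightarrow> 'w \<Rightarrow> real) \<Rightarrow> ('x \<Rightarrow> real) \<Rightarrow> bool" where
  "has_covariance_function M B C \<longleftrightarrow> (\<forall>x y. covariance M (B x) (B y) = C (x - y))"

abbreviation dilate :: "real \<Rightarrow> 'x::real_vector set \<Rightarrow> 'x set" where
  "dilate t D \<equiv> (\<lambda>x. t *\<^sub>R x) ` D"

definition Y_functional ::
  "(('x::euclidean_space \<times> 'y::euclidean_space) \<Rightarrow> 'w \<Rightarrow> real) \<Rightarrow>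
   'x set \<Rightarrow> 'y set \<Rightarrow> nat \<Rightarrow> real \<Rightarrow> real \<Rightarrow> 'w \<Rightarrow> real" where
  "Y_functional B D1 D2 q t1 t2 \<omega> =
     (LINT x:(dilate t1 D1 \<times> dilate t2 D2)|lborel. hermite q (B x \<omega>))"

definition A_functional ::
  "('x::euclidean_space \<Rightarrow> 'w \<Rightarrow> real) \<Rightarrow> ('x \<Rightarrow> real) \<Rightarrow>
   'x set \<Rightarrow> nat \<Rightarrow> real \<Rightarrow> 'w \<Rightarrow> real" where
  "A_functional B K D q t \<omega> =
     (LINT x:dilate t D|lborel. hermite q (B x \<omega> / sqrt (K 0)))"

definition gamma_ratio ::
  "('x::euclidean_space \<Rightarrow> real) \<Rightarrow> 'x set \<Rightarrow> nat \<Rightarrow> real \<Rightarrow> real" where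
  "gamma_ratio K D q t =
     (LINT z:(dilate t D \<times> dilate t D)|lborel. K (fst z - snd z) ^ q)
       / (measure lborel (dilate t D))\<^sup>2"

definition standardize :: "'w measure \<Rightarrow> ('w \<Rightarrow> real) \<Rightarrow> 'w \<Rightarrow> real" where
  "standardize M Z \<omega> = (Z \<omega> - integral\<^sup>L M Z) / sqrt (covariance M Z Z)"

definition converges_in_distribution ::
  "'w measure \<Rightarrow> ('t \<Rightarrow> 'w \<Rightarrow> real) \<Rightarrow> real measure \<Rightarrow> 't filter \<Rightarrow> bool" where
  "converges_in_distribution M X \<mu> F \<longleftrightarrow>
     (\<forall>x. isCont (cdf \<mu>) x \<longrightarrow> ((\<lambda>t. cdf (distr M borel (X t)) x) \<longlongrightarrow> cdf \<mu> x) F)"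

lemma converges_in_distribution_sequentially:
  "converges_in_distribution M X \<mu> sequentially \<longleftrightarrow>
     weak_conv_m (\<lambda>n. distr M borel (X n)) \<mu>"
  by (simp add: converges_in_distribution_def weak_conv_m_def weak_conv_def)

text \<open>
  A mode in which a pair (t1, t2) of parameters tends to infinity. Requiring that the image
  of the filter under the second projection is all of \<^const>\<open>at_top\<close>, rather than only finer,
  means that the limit in t2 alone is the unrestricted one. The lemmas below
  show that this covers independent growth of t1 and t2 as well as any coupling t1 = h(t2).
  The coupled modes matter: for independent growth the ratio f(t1) / g(t2) of positive
  functions can vanish only if g stays away from 0.
\<close>

definition both_at_top :: "(real \<times> real) filter \<Rightarrow> bool" where
  "both_at_top F \<longleftrightarrow> filterlim fst at_top F \<and> filtermap snd F = at_top"

lemma both_at_top_prod: "both_at_top (at_top \<times>\<^sub>F at_top)"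
proof -
  have "at_top \<le> filtermap snd ((at_top :: real filter) \<times>\<^sub>F (at_top :: real filter))"
  proof (rule filter_leI)
    fix P :: "real \<Rightarrow> bool"
    assume "eventually P (filtermap snd ((at_top :: real filter) \<times>\<^sub>F at_top))"
    then obtain Q R where QR: "eventually Q (at_top :: real filter)" "eventually R at_top"
        "\<And>x y. Q x \<Longrightarrow> R y \<Longrightarrow> P y"
      by (auto simp: eventually_filtermap eventually_prod_filter)
    from eventually_happens[OF QR(1)] obtain x where "Q x" by auto
    with QR(2,3) show "eventually P at_top" by (auto elim: eventually_mono)
  qed
  moreover have "filtermap snd ((at_top :: real filter) \<times>\<^sub>F (at_top :: real filter)) \<le> at_top"
    using filterlim_snd by (simp add: filterlim_def)
  ultimately show ?thesis
    by (auto simp: both_at_top_def filterlim_fst)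
qed

lemma both_at_top_coupled:
  assumes "filterlim h at_top at_top"
  shows "both_at_top (filtermap (\<lambda>t. (h t, t)) at_top)"
  using assms by (simp add: both_at_top_def filterlim_filtermap filtermap_filtermap)

end

theory Submission
  imports Defs "HOL-Computational_Algebra.Polynomial" "HOL-Computational_Algebra.Formal_Power_Series"
begin

text \<open>
  The law of Y is computed on the product of the probability spaces of B1 and B2, where B1 + B2 has
  the finite-dimensional distributions of B. The addition formula for Hermite polynomials gives
  Y as the sum over k of binom(q, k) K1(0)^(k/2) K2(0)^((q - k)/2) A1[k] A2[q - k]. The term k = 0
  is a positive multiple of A2[q]. By E H_k(U) H_k(V) = k! (E U V)^k, the ratio of the second moments
  of the terms k and 0 is a constant times gamma1[k] gamma2[q - k] / gamma2[q], which by comparison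
  of the power means of K1 and K2 is at most a constant times (gamma1[q] / gamma2[q])^(k/q). So the
  terms k > 0 are negligible in L2, and standardising does not change that.
\<close>

section \<open>Hermite polynomials\<close>

text \<open>The obstacle is that \<open>B\<close>, \<open>B1\<close> and \<open>B2\<close> live on
  three unrelated probability spaces, so Y is not expanded where B lives: the sum field shares only
  its finite-dimensional distributions with B, and these must be shown to determine the law of an
  integral over paths. No law on path space is built. A path integral is a pointwise limit of
  functions of finitely many coordinates, and finite-dimensional laws are compared through the
  numbers E cos(S + b) for linear forms S. The phase b stands in for complex exponentials: it yields
  real and imaginary parts, and under independence it absorbs the other summand. The term k = 0
  depends on t1 only through a deterministic volume, which standardising removes; this is why a
  limit in t2 alone can be equivalent to a joint one. Nonnegativity of K1 and K2, with continuity
  and K1(0), K2(0) > 0, makes every gamma positive and allows powers k \<le> q to be compared with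
  the power q. L2 closeness is symmetric, so a single estimate serves both directions.\<close>

lemma hermite_recursion:
  "hermite (Suc n) x = x * hermite n x - real n * hermite (n - 1) x"
  by (cases n) auto

text \<open>The generating function exp(a x T - a^2 T^2 / 2), given by its coefficients because only
  its differential equation is used.\<close>

definition hermite_fps :: "real \<Rightarrow> real \<Rightarrow> real fps" where
  "hermite_fps a x = Abs_fps (\<lambda>k. a ^ k * hermite k x / fact k)"

text \<open>Coefficientwise this is the three-term recursion of the Hermite polynomials, scaled by
  \<open>a ^ Suc n / fact n\<close>.\<close>

lemma fps_deriv_hermite_fps:
  "fps_deriv (hermite_fps a x) = (fps_const (a * x) - fps_const (a\<^sup>2) * fps_X) * hermite_fps a x"
proof (rule fps_ext)
  fix n
  have "real (Suc n) * (a ^ Suc n * hermite (Suc n) x / fact (Suc n))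
      = a * x * (a ^ n * hermite n x / fact n) - a\<^sup>2 * (if n = 0 then 0 else a ^ (n - 1) * hermite (n - 1) x / fact (n - 1))"
  proof (cases n)
    case 0
    then show ?thesis by simp
  next
    case (Suc m)
    have "real (Suc n) * (a ^ Suc n * hermite (Suc n) x / fact (Suc n)) = a ^ Suc n * hermite (Suc n) x / fact n"
      unfolding fact_Suc of_nat_mult by (simp del: hermite.simps power_Suc of_nat_Suc)
    also have "\<dots> = a ^ Suc n * (x * hermite n x) / fact n - a ^ Suc n * (real n * hermite m x) / fact n"
      using hermite_recursion[of n x] Suc
      by (simp only: diff_Suc_1 right_diff_distrib diff_divide_distrib)
    also have "a ^ Suc n * (real n * hermite m x) / fact n = a\<^sup>2 * (a ^ m * hermite m x / fact m)"
    proof -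
      have "fact n = real n * fact m" "a ^ Suc n = a\<^sup>2 * a ^ m" "real n \<noteq> 0"
        using Suc by (simp_all add: power2_eq_square)
      then show ?thesis by simp
    qed
    finally show ?thesis using Suc by (simp add: field_simps del: hermite.simps)
  qed
  then show "fps_nth (fps_deriv (hermite_fps a x)) n
      = fps_nth ((fps_const (a * x) - fps_const (a\<^sup>2) * fps_X) * hermite_fps a x) n"
    by (simp add: hermite_fps_def left_diff_distrib mult.assoc del: hermite.simps fact_Suc)
qed

text \<open>The generating functions of both sides solve G' = (a x + b y - T) G with constant term
  1. The hypothesis enters only in merging the coefficients \<open>a\<^sup>2\<close> and
  \<open>b\<^sup>2\<close> of T into 1.\<close>

lemma hermite_add:
  assumes "a\<^sup>2 + b\<^sup>2 = 1"
  shows "hermite n (a * x + b * y)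
    = (\<Sum>k\<le>n. real (n choose k) * (a ^ k * b ^ (n - k)) * (hermite k x * hermite (n - k) y))"
proof -
  let ?D = "fps_const (a * x + b * y) - fps_X"
  \<comment> \<open>The equation expresses coefficient n + 1 through coefficients n and n - 1, so
    the constant term determines the whole series.\<close>
  have ode_unique: "G = H" if "fps_deriv G = ?D * G" "fps_deriv H = ?D * H" "fps_nth G 0 = fps_nth H 0"
    for G H :: "real fps"
  proof (rule fps_ext)
    fix n
    have step: "real (Suc n) * fps_nth W (Suc n) = (a * x + b * y) * fps_nth W n - (if n = 0 then 0 else fps_nth W (n - 1))"
      if "fps_deriv W = ?D * W" for W :: "real fps" and n
      using arg_cong[OF that, of "\<lambda>V. fps_nth V n"] by (simp add: left_diff_distrib)
    show "fps_nth G n = fps_nth H n"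
    proof (induction n rule: less_induct)
      case (less n)
      show ?case
      proof (cases n)
        case 0
        then show ?thesis using that by simp
      next
        case (Suc m)
        have "real (Suc m) * fps_nth G (Suc m) = real (Suc m) * fps_nth H (Suc m)"
          unfolding step[OF that(1)] step[OF that(2)] using less Suc by simp
        then show ?thesis using Suc by simp
      qed
    qed
  qed
  have eq: "hermite_fps 1 (a * x + b * y) = hermite_fps a x * hermite_fps b y"
  proof (rule ode_unique)
    show "fps_deriv (hermite_fps 1 (a * x + b * y)) = ?D * hermite_fps 1 (a * x + b * y)"
      using fps_deriv_hermite_fps[of 1 "a * x + b * y"] by simp
    have "fps_const (a\<^sup>2) * fps_X + fps_const (b\<^sup>2) * fps_X = fps_const (a\<^sup>2 + b\<^sup>2) * (fps_X :: real fps)"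
      by (simp only: fps_const_add[symmetric] distrib_right)
    then have X: "fps_const (a\<^sup>2) * fps_X + fps_const (b\<^sup>2) * fps_X = (fps_X :: real fps)"
      using assms by simp
    have "fps_deriv (hermite_fps a x * hermite_fps b y)
        = (fps_const (a * x) + fps_const (b * y) - (fps_const (a\<^sup>2) * fps_X + fps_const (b\<^sup>2) * fps_X))
          * (hermite_fps a x * hermite_fps b y)"
      unfolding fps_deriv_mult fps_deriv_hermite_fps by algebra
    then show "fps_deriv (hermite_fps a x * hermite_fps b y) = ?D * (hermite_fps a x * hermite_fps b y)"
      unfolding X by simp
  qed (simp add: hermite_fps_def)
  have "hermite n (a * x + b * y) / fact n
      = (\<Sum>k\<le>n. (a ^ k * hermite k x / fact k) * (b ^ (n - k) * hermite (n - k) y / fact (n - k)))"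
    using arg_cong[OF eq, of "\<lambda>V. fps_nth V n"] by (simp add: hermite_fps_def fps_mult_nth atLeast0AtMost)
  then have "hermite n (a * x + b * y)
      = fact n * (\<Sum>k\<le>n. (a ^ k * hermite k x / fact k) * (b ^ (n - k) * hermite (n - k) y / fact (n - k)))"
    by (simp add: field_simps)
  also have "\<dots> = (\<Sum>k\<le>n. real (n choose k) * (a ^ k * b ^ (n - k)) * (hermite k x * hermite (n - k) y))"
    unfolding sum_distrib_left by (rule sum.cong) (auto simp: binomial_fact field_simps)
  finally show ?thesis .
qed

text \<open>A copy as formal polynomials, so that Gaussian integration by parts can be reduced to
  monomials and \<open>pderiv\<close> is available.\<close>

fun hermite_poly :: "nat \<Rightarrow> real poly" where
  "hermite_poly 0 = 1"
| "hermite_poly (Suc 0) = [:0, 1:]"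
| "hermite_poly (Suc (Suc n)) = [:0, 1:] * hermite_poly (Suc n) - smult (real (Suc n)) (hermite_poly n)"

lemma poly_hermite_poly: "poly (hermite_poly n) x = hermite n x"
  by (induction n rule: hermite_poly.induct) (simp_all add: algebra_simps)

lemma hermite_poly_recursion:
  "hermite_poly (Suc n) = [:0, 1:] * hermite_poly n - smult (real n) (hermite_poly (n - 1))"
  by (cases n) auto

lemma pderiv_hermite_poly: "pderiv (hermite_poly (Suc n)) = smult (real (Suc n)) (hermite_poly n)"
proof -
  have "poly (pderiv (hermite_poly (Suc n))) x = poly (smult (real (Suc n)) (hermite_poly n)) x" for x
    using DERIV_unique[OF poly_DERIV[of "hermite_poly (Suc n)" x]] hermite_has_derivative[of n x]
    by (simp add: poly_hermite_poly del: hermite_poly.simps)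
  then show ?thesis by (simp add: poly_eq_poly_eq_iff[symmetric] fun_eq_iff)
qed

lemma continuous_on_hermite [continuous_intros]: "continuous_on A f \<Longrightarrow> continuous_on A (\<lambda>x. hermite n (f x))"
  unfolding poly_hermite_poly[symmetric] by (intro continuous_intros)

lemma hermite_measurable [measurable]: "hermite n \<in> borel_measurable borel"
  by (intro borel_measurable_continuous_onI continuous_intros)

section \<open>Hermite polynomials under the standard normal law\<close>

lemma integrable_std_normal_poly: "integrable std_normal_distribution (poly p)"
  unfolding poly_altdef
  by (intro Bochner_Integration.integrable_sum integrable_mult_right integrable_std_normal_distribution_moment)

text \<open>For odd n this is the ratio of consecutive even moments (2k)! / (2^k k!). For even n
  both sides vanish by symmetry; at n = 0 the truncated exponent \<open>n - 1\<close> is harmless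
  because of the factor 0.\<close>

lemma std_normal_stein_monomial:
  "(LINT x|std_normal_distribution. x ^ Suc n) = real n * (LINT x|std_normal_distribution. x ^ (n - 1))"
proof (cases "even n")
  case True
  then have "odd (Suc n)" "n = 0 \<or> odd (n - 1)" by auto
  then show ?thesis by (auto simp: integral_std_normal_distribution_moment_odd simp del: power_Suc)
next
  case False
  then obtain k where n: "n = 2 * k + 1" by (auto elim: oddE)
  then have "Suc n = 2 * Suc k" "n - 1 = 2 * k" by auto
  then have "(LINT x|std_normal_distribution. x ^ Suc n) = fact (2 * Suc k) / (2 ^ Suc k * fact (Suc k))"
    "(LINT x|std_normal_distribution. x ^ (n - 1)) = fact (2 * k) / (2 ^ k * fact k)"
    using std_normal_distribution_even_moments(1)[of "Suc k"] std_normal_distribution_even_moments(1)[of k]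
    by simp_all
  moreover have "fact (2 * Suc k) = (2 * real (Suc k)) * real n * fact (2 * k)"
    using n by (simp add: algebra_simps)
  ultimately have "(LINT x|std_normal_distribution. x ^ Suc n)
      = (2 * real (Suc k)) * real n * fact (2 * k) / (2 * 2 ^ k * (real (Suc k) * fact k))"
    "(LINT x|std_normal_distribution. x ^ (n - 1)) = fact (2 * k) / (2 ^ k * fact k)"
    by (simp_all only: power_Suc fact_Suc of_nat_mult of_nat_fact)
  then show ?thesis by (simp del: of_nat_Suc)
qed

text \<open>Gaussian integration by parts. Linearity reduces it to monomials, so no boundary terms
  have to be estimated.\<close>

lemma std_normal_stein:
  "(LINT x|std_normal_distribution. x * poly p x) = (LINT x|std_normal_distribution. poly (pderiv p) x)"
proof -
  let ?m = "\<lambda>i. LINT x|std_normal_distribution. x ^ i"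
  have "(LINT x|std_normal_distribution. x * poly p x)
      = (LINT x|std_normal_distribution. (\<Sum>i\<le>degree p. coeff p i * x ^ Suc i))"
    by (simp add: poly_altdef sum_distrib_left mult_ac)
  also have "\<dots> = (\<Sum>i\<le>degree p. coeff p i * ?m (Suc i))"
    by (subst Bochner_Integration.integral_sum)
       (auto intro!: integrable_std_normal_distribution_moment simp del: power_Suc)
  also have "\<dots> = (\<Sum>i\<le>degree p. coeff p i * (real i * ?m (i - 1)))"
    by (simp only: std_normal_stein_monomial)
  also have "\<dots> = (LINT x|std_normal_distribution. (\<Sum>i\<le>degree p. coeff p i * (real i * x ^ (i - 1))))"
    by (subst Bochner_Integration.integral_sum)
       (auto intro!: integrable_std_normal_distribution_moment)
  also have "(\<lambda>x. (\<Sum>i\<le>degree p. coeff p i * (real i * x ^ (i - 1)))) = poly (pderiv p)"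
  proof
    fix x
    have pderiv_sum: "pderiv (sum g A) = (\<Sum>i\<in>A. pderiv (g i))" for g :: "nat \<Rightarrow> real poly" and A
      by (induction A rule: infinite_finite_induct) (simp_all add: pderiv_add)
    have "pderiv p = (\<Sum>i\<le>degree p. pderiv (monom (coeff p i) i))"
      by (subst (1) poly_as_sum_of_monoms[symmetric]) (rule pderiv_sum)
    then show "(\<Sum>i\<le>degree p. coeff p i * (real i * x ^ (i - 1))) = poly (pderiv p) x"
      by (simp add: poly_sum pderiv_monom poly_monom mult_ac)
  qed
  finally show ?thesis .
qed

text \<open>The operator p -> x p - p' is adjoint to the derivative under the Gaussian law, and it
  maps H_n to H_(n+1). Taking p = 1 gives mean zero, and iterating with p = H_(n+1) gives E H_n^2 =
  n!.\<close>

lemma std_normal_hermite_poly_Suc: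
  "(LINT x|std_normal_distribution. poly (hermite_poly (Suc n) * p) x)
    = (LINT x|std_normal_distribution. poly (hermite_poly n * pderiv p) x)"
proof -
  have d: "pderiv (hermite_poly n) = smult (real n) (hermite_poly (n - 1))"
    by (cases n) (simp_all add: pderiv_hermite_poly pderiv_1 del: hermite_poly.simps(2,3))
  have "(LINT x|std_normal_distribution. poly (hermite_poly (Suc n) * p) x)
      = (LINT x|std_normal_distribution. x * poly (hermite_poly n * p) x - poly (smult (real n) (hermite_poly (n - 1)) * p) x)"
    unfolding hermite_poly_recursion by (simp add: algebra_simps)
  also have "\<dots> = (LINT x|std_normal_distribution. x * poly (hermite_poly n * p) x)
      - (LINT x|std_normal_distribution. poly (smult (real n) (hermite_poly (n - 1)) * p) x)"
    by (rule Bochner_Integration.integral_diff)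
       (use integrable_std_normal_poly[of "[:0, 1:] * (hermite_poly n * p)"]
          integrable_std_normal_poly[of "smult (real n) (hermite_poly (n - 1)) * p"] in
          \<open>simp_all only: poly_mult[abs_def] poly_pCons poly_0 mult_zero_right add_0_right add_0_left mult_1_right\<close>)
  also have "\<dots> = (LINT x|std_normal_distribution. poly (pderiv (hermite_poly n * p)) x
      - poly (smult (real n) (hermite_poly (n - 1)) * p) x)"
    unfolding std_normal_stein by (rule Bochner_Integration.integral_diff[symmetric]) (rule integrable_std_normal_poly)+
  also have "\<dots> = (LINT x|std_normal_distribution. poly (hermite_poly n * pderiv p) x)"
    by (rule Bochner_Integration.integral_cong) (simp_all add: pderiv_mult d algebra_simps)
  finally show ?thesis .
qed

lemma std_normal_hermite_integral:
  assumes "n > 0"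
  shows "(LINT x|std_normal_distribution. hermite n x) = 0"
  using std_normal_hermite_poly_Suc[of "n - 1" 1] assms
  by (simp add: poly_hermite_poly pderiv_1)

lemma std_normal_hermite_square:
  "(LINT x|std_normal_distribution. (hermite n x)\<^sup>2) = fact n"
proof -
  interpret real_distribution std_normal_distribution by (rule real_dist_normal_dist)
  have "(LINT x|std_normal_distribution. poly (hermite_poly n * hermite_poly n) x) = fact n"
  proof (induction n)
    case 0
    then show ?case using prob_space by simp
  next
    case (Suc n)
    then show ?case
      unfolding std_normal_hermite_poly_Suc pderiv_hermite_poly mult_smult_right poly_smult
      by simp
  qed
  then show ?thesis by (simp add: poly_hermite_poly power2_eq_square)
qed

lemma integrable_std_normal_hermite: "integrable std_normal_distribution (\<lambda>x. hermite n x)"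
  "integrable std_normal_distribution (\<lambda>x. (hermite n x)\<^sup>2)"
  using integrable_std_normal_poly[of "hermite_poly n"] integrable_std_normal_poly[of "hermite_poly n * hermite_poly n"]
  unfolding poly_mult[abs_def] poly_hermite_poly[abs_def] power2_eq_square poly_hermite_poly by simp_all

section \<open>Finite-dimensional distributions\<close>

text \<open>After division by the common total mass m the weights become probability densities. The
  phases b = 0 and b = -pi/2 turn the hypothesis into equality of the real and imaginary parts of
  the characteristic functions, and Levy's theorem applies.\<close>

lemma Levy_uniqueness_weighted:
  fixes X w :: "'w \<Rightarrow> real" and Y v :: "'v \<Rightarrow> real"
  assumes "prob_space M" "prob_space N"
    and X [measurable]: "X \<in> borel_measurable M" and Y [measurable]: "Y \<in> borel_measurable N"
    and w [measurable]: "w \<in> borel_measurable M" and v [measurable]: "v \<in> borel_measurable N"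
    and w_bounds: "\<And>\<omega>. 0 \<le> w \<omega>" "\<And>\<omega>. w \<omega> \<le> c" and v_bounds: "\<And>\<omega>. 0 \<le> v \<omega>" "\<And>\<omega>. v \<omega> \<le> c"
    and eq: "\<And>t b. (LINT \<omega>|M. w \<omega> * cos (t * X \<omega> + b)) = (LINT \<omega>|N. v \<omega> * cos (t * Y \<omega> + b))"
    and A [measurable]: "A \<in> sets borel"
  shows "(LINT \<omega>|M. w \<omega> * indicator A (X \<omega>)) = (LINT \<omega>|N. v \<omega> * indicator A (Y \<omega>))"
proof -
  define m where "m = (LINT \<omega>|M. w \<omega>)"
  have m': "m = (LINT \<omega>|N. v \<omega>)" using eq[of 0 0] by (simp add: m_def)
  have law: "real_distribution (distr (density P (\<lambda>\<omega>. ennreal (u \<omega> / m))) borel Z)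
      \<and> (\<forall>t. char (distr (density P (\<lambda>\<omega>. ennreal (u \<omega> / m))) borel Z) t
        = Complex ((LINT \<omega>|P. u \<omega> * cos (t * Z \<omega> + 0)) / m) ((LINT \<omega>|P. u \<omega> * cos (t * Z \<omega> + (- pi / 2))) / m))
      \<and> measure (distr (density P (\<lambda>\<omega>. ennreal (u \<omega> / m))) borel Z) A = (LINT \<omega>|P. u \<omega> * indicator A (Z \<omega>)) / m"
    if "prob_space P" and [measurable]: "Z \<in> borel_measurable P" "u \<in> borel_measurable P"
      and u: "\<And>\<omega>. 0 \<le> u \<omega>" "\<And>\<omega>. u \<omega> \<le> c" and um: "(LINT \<omega>|P. u \<omega>) = m" and m: "m > 0"
    for P :: "'x measure" and u Z :: "'x \<Rightarrow> real"
  proof (intro conjI allI)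
    interpret P: prob_space P by fact
    let ?D = "density P (\<lambda>\<omega>. ennreal (u \<omega> / m))"
    have int_u: "integrable P u"
      by (rule P.integrable_const_bound[of _ c]) (use u in auto)
    have "(\<integral>\<^sup>+ \<omega>. ennreal (u \<omega> / m) \<partial>P) = 1"
      by (subst nn_integral_eq_integral) (use int_u u m um in auto)
    then interpret D: prob_space ?D
      by (intro prob_spaceI) (simp add: emeasure_density)
    show "real_distribution (distr ?D borel Z)"
      by (simp add: real_distribution_def real_distribution_axioms_def D.prob_space_distr)
    show "char (distr ?D borel Z) t
        = Complex ((LINT \<omega>|P. u \<omega> * cos (t * Z \<omega> + 0)) / m) ((LINT \<omega>|P. u \<omega> * cos (t * Z \<omega> + (- pi / 2))) / m)" for t
    proof -
      have "char (distr ?D borel Z) t = (LINT \<omega>|P. (u \<omega> / m) *\<^sub>R iexp (t * Z \<omega>))"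
        unfolding char_def by (subst integral_distr) (auto intro!: integral_density simp: u less_imp_le[OF m])
      moreover have i: "integrable P (\<lambda>\<omega>. (u \<omega> / m) *\<^sub>R iexp (t * Z \<omega>))"
        by (rule P.integrable_const_bound[of _ "c / m"]) (use u m in \<open>auto simp: divide_right_mono\<close>)
      ultimately show ?thesis
        unfolding complex_eq_iff complex.sel
        by (simp only: integral_Re[OF i, symmetric] integral_Im[OF i, symmetric])
           (simp add: Re_exp Im_exp cos_diff)
    qed
    have "measure (distr ?D borel Z) A = (LINT x|distr ?D borel Z. indicator A x)" by simp
    also have "\<dots> = (LINT \<omega>|?D. indicator A (Z \<omega>))" by (rule integral_distr) auto
    also have "\<dots> = (LINT \<omega>|P. u \<omega> * indicator A (Z \<omega>)) / m"
      by (subst integral_density) (use u m in \<open>auto simp: less_imp_le\<close>)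
    finally show "measure (distr ?D borel Z) A = (LINT \<omega>|P. u \<omega> * indicator A (Z \<omega>)) / m" .
  qed
  show ?thesis
  proof (cases "m > 0")
    case True
    note LM = law[OF assms(1) X w w_bounds m_def[symmetric] True]
    note LN = law[OF assms(2) Y v v_bounds m'[symmetric] True]
    have "distr (density M (\<lambda>\<omega>. ennreal (w \<omega> / m))) borel X = distr (density N (\<lambda>\<omega>. ennreal (v \<omega> / m))) borel Y"
      using LM LN by (intro Levy_uniqueness) (auto simp only: fun_eq_iff eq)
    then show ?thesis using LM LN True by simp
  next
    \<comment> \<open>Without mass there is nothing to normalise, but then both integrals lie
      between 0 and m, which is at most 0.\<close>
    case False
    have zero: "(LINT \<omega>|P. u \<omega> * indicator A (Z \<omega>)) = 0"
      if "prob_space P" and [measurable]: "Z \<in> borel_measurable P" "u \<in> borel_measurable P"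
        and u: "\<And>\<omega>. 0 \<le> u \<omega>" "\<And>\<omega>. u \<omega> \<le> c" and um: "(LINT \<omega>|P. u \<omega>) = m"
      for P :: "'x measure" and u Z :: "'x \<Rightarrow> real"
    proof -
      interpret P: prob_space P by fact
      have "(LINT \<omega>|P. u \<omega> * indicator A (Z \<omega>)) \<le> (LINT \<omega>|P. u \<omega>)"
        by (intro integral_mono P.integrable_const_bound[of _ c])
           (use u order_trans[OF u] in \<open>auto simp: indicator_def\<close>)
      moreover have "0 \<le> (LINT \<omega>|P. u \<omega> * indicator A (Z \<omega>))"
        using u by (intro Bochner_Integration.integral_nonneg) auto
      ultimately show ?thesis using um False by simp
    qed
    show ?thesis
      using zero[OF assms(1) X w w_bounds m_def[symmetric]] zero[OF assms(2) Y v v_bounds m'[symmetric]] by simp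
  qed
qed

text \<open>Induction on the coordinates already localised by indicators: with these fixed, 1 + cos is a
  nonnegative weight, so the law of the next coordinate under it is given by Levy's theorem.\<close>

lemma integral_indicators_cos_eq:
  fixes X :: "'i \<Rightarrow> 'w \<Rightarrow> real" and Y :: "'i \<Rightarrow> 'v \<Rightarrow> real"
  assumes "prob_space M" "prob_space N"
    and [measurable]: "\<And>i. X i \<in> borel_measurable M" "\<And>i. Y i \<in> borel_measurable N"
    and "finite I"
    and eq: "\<And>a b. (LINT \<omega>|M. cos ((\<Sum>i\<in>I. a i * X i \<omega>) + b)) = (LINT \<omega>|N. cos ((\<Sum>i\<in>I. a i * Y i \<omega>) + b))"
    and "J \<subseteq> I" and A: "\<And>j. A j \<in> sets borel"
  shows "(LINT \<omega>|M. (\<Prod>j\<in>J. indicator (A j) (X j \<omega>)) * cos ((\<Sum>i\<in>I. a i * X i \<omega>) + b))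
    = (LINT \<omega>|N. (\<Prod>j\<in>J. indicator (A j) (Y j \<omega>)) * cos ((\<Sum>i\<in>I. a i * Y i \<omega>) + b))"
  using finite_subset[OF \<open>J \<subseteq> I\<close> \<open>finite I\<close>] \<open>J \<subseteq> I\<close>
proof (induction J arbitrary: a b)
  case empty
  then show ?case using eq by simp
next
  case (insert l J)
  interpret M: prob_space M by fact
  interpret N: prob_space N by fact
  have [measurable]: "A j \<in> sets borel" for j by fact
  have l: "l \<in> I" "finite J" "l \<notin> J" using insert by auto
  define u where "u z = (\<Prod>j\<in>J. indicator (A j) (z j) :: real)" for z :: "'i \<Rightarrow> real"
  define \<theta> where "\<theta> z = (\<Sum>i\<in>I. a i * z i) + b" for z :: "'i \<Rightarrow> real"
  have uM: "0 \<le> u (\<lambda>i. X i \<omega>)" "u (\<lambda>i. X i \<omega>) \<le> 1" for \<omega> unfolding u_def by (auto intro!: prod_nonneg prod_le_1)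
  have uN: "0 \<le> u (\<lambda>i. Y i \<omega>)" "u (\<lambda>i. Y i \<omega>) \<le> 1" for \<omega> unfolding u_def by (auto intro!: prod_nonneg prod_le_1)
  have [measurable]: "(\<lambda>\<omega>. u (\<lambda>i. X i \<omega>)) \<in> borel_measurable M" "(\<lambda>\<omega>. u (\<lambda>i. Y i \<omega>)) \<in> borel_measurable N"
     "(\<lambda>\<omega>. \<theta> (\<lambda>i. X i \<omega>)) \<in> borel_measurable M" "(\<lambda>\<omega>. \<theta> (\<lambda>i. Y i \<omega>)) \<in> borel_measurable N" unfolding u_def \<theta>_def by measurable
  have abs_bound: "\<bar>x * y\<bar> \<le> 1" if "\<bar>x\<bar> \<le> 1" "\<bar>y\<bar> \<le> 1" for x y :: real
    using mult_mono[OF that] by (simp add: abs_mult)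
  have iM: "integrable M (\<lambda>\<omega>. u (\<lambda>i. X i \<omega>) * g \<omega>)"
    if "g \<in> borel_measurable M" "\<And>\<omega>. \<bar>g \<omega>\<bar> \<le> 1" for g
    by (rule M.integrable_const_bound[of _ 1]) (use that uM in \<open>auto intro!: abs_bound\<close>)
  have iN: "integrable N (\<lambda>\<omega>. u (\<lambda>i. Y i \<omega>) * g \<omega>)"
    if "g \<in> borel_measurable N" "\<And>\<omega>. \<bar>g \<omega>\<bar> \<le> 1" for g
    by (rule N.integrable_const_bound[of _ 1]) (use that uN in \<open>auto intro!: abs_bound\<close>)
  \<comment> \<open>Adding or subtracting a multiple of coordinate l only changes the coefficient at
    l, so the induction hypothesis, general in \<open>a\<close> and \<open>b\<close>, covers all the
    cosines below.\<close>
  have single: "t * z l + c = (\<Sum>i\<in>I. (if i = l then t else 0) * z i) + c"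
    for t c and z :: "'i \<Rightarrow> real"
    using l \<open>finite I\<close> by (simp add: if_distrib[of "\<lambda>x. x * _"] sum.delta cong: if_cong)
  have plus: "\<theta> z + (t * z l + c) = (\<Sum>i\<in>I. (a i + (if i = l then t else 0)) * z i) + (b + c)"
    for t c and z :: "'i \<Rightarrow> real"
    unfolding single \<theta>_def by (simp add: distrib_right sum.distrib)
  have minus: "\<theta> z - (t * z l + c) = (\<Sum>i\<in>I. (a i - (if i = l then t else 0)) * z i) + (b - c)"
    for t c and z :: "'i \<Rightarrow> real"
    unfolding single \<theta>_def by (simp add: left_diff_distrib sum_subtractf)
  note IH = insert.IH[folded u_def]
  have IH0: "(LINT \<omega>|M. u (\<lambda>i. X i \<omega>) * cos (t * X l \<omega> + c)) = (LINT \<omega>|N. u (\<lambda>i. Y i \<omega>) * cos (t * Y l \<omega> + c))" for t c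
  proof -
    have "t * X l \<omega> + c = (\<Sum>i\<in>I. (if i = l then t else 0) * X i \<omega>) + c" for \<omega> by (rule single)
    moreover have "t * Y l \<omega> + c = (\<Sum>i\<in>I. (if i = l then t else 0) * Y i \<omega>) + c" for \<omega> by (rule single)
    ultimately show ?thesis by (simp only:) (rule IH, use insert.prems in simp)
  qed
  have IH1: "(LINT \<omega>|M. u (\<lambda>i. X i \<omega>) * cos (\<theta> (\<lambda>i. X i \<omega>) + (t * X l \<omega> + c))) = (LINT \<omega>|N. u (\<lambda>i. Y i \<omega>) * cos (\<theta> (\<lambda>i. Y i \<omega>) + (t * Y l \<omega> + c)))" for t c
  proof -
    let ?S = "\<lambda>z. (\<Sum>i\<in>I. (a i + (if i = l then t else 0)) * z i) + (b + c)"
    have "\<theta> (\<lambda>i. X i \<omega>) + (t * X l \<omega> + c) = ?S (\<lambda>i. X i \<omega>)" for \<omega> by (rule plus)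
    moreover have "\<theta> (\<lambda>i. Y i \<omega>) + (t * Y l \<omega> + c) = ?S (\<lambda>i. Y i \<omega>)" for \<omega> by (rule plus)
    ultimately show ?thesis by (simp only:) (rule IH, use insert.prems in simp)
  qed
  have IH2: "(LINT \<omega>|M. u (\<lambda>i. X i \<omega>) * cos (\<theta> (\<lambda>i. X i \<omega>) - (t * X l \<omega> + c))) = (LINT \<omega>|N. u (\<lambda>i. Y i \<omega>) * cos (\<theta> (\<lambda>i. Y i \<omega>) - (t * Y l \<omega> + c)))" for t c
  proof -
    let ?S = "\<lambda>z. (\<Sum>i\<in>I. (a i - (if i = l then t else 0)) * z i) + (b - c)"
    have "\<theta> (\<lambda>i. X i \<omega>) - (t * X l \<omega> + c) = ?S (\<lambda>i. X i \<omega>)" for \<omega> by (rule minus)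
    moreover have "\<theta> (\<lambda>i. Y i \<omega>) - (t * Y l \<omega> + c) = ?S (\<lambda>i. Y i \<omega>)" for \<omega> by (rule minus)
    ultimately show ?thesis by (simp only:) (rule IH, use insert.prems in simp)
  qed
  \<comment> \<open>The product-to-sum formula leaves only cosines of linear forms weighted by
    \<open>u\<close>, whose integrals are already known to agree.\<close>
  have expand: "u z * (1 + cos (\<theta> z)) * cos r
      = u z * cos r + (u z * cos (\<theta> z + r) + u z * cos (\<theta> z - r)) / 2"
    for z :: "'i \<Rightarrow> real" and r
    by (simp add: cos_add cos_diff algebra_simps)
  have cos_le: "cos r \<le> 1" "0 \<le> 1 + cos r" for r :: real
    using cos_ge_minus_one[of r] cos_le_one[of r] by linarith+
  have "(LINT \<omega>|M. u (\<lambda>i. X i \<omega>) * (1 + cos (\<theta> (\<lambda>i. X i \<omega>))) * cos (t * X l \<omega> + c))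
      = (LINT \<omega>|N. u (\<lambda>i. Y i \<omega>) * (1 + cos (\<theta> (\<lambda>i. Y i \<omega>))) * cos (t * Y l \<omega> + c))" for t c
    unfolding expand using IH0[of t c] IH1[of t c] IH2[of t c]
    by (simp add: iM iN add_divide_distrib)
  moreover have "u (\<lambda>i. X i \<omega>) * (1 + cos (\<theta> (\<lambda>i. X i \<omega>))) \<le> 2" "u (\<lambda>i. Y i \<omega>') * (1 + cos (\<theta> (\<lambda>i. Y i \<omega>'))) \<le> 2" for \<omega> \<omega>'
    using mult_mono[of "u (\<lambda>i. X i \<omega>)" 1 "1 + cos (\<theta> (\<lambda>i. X i \<omega>))" 2] mult_mono[of "u (\<lambda>i. Y i \<omega>')" 1 "1 + cos (\<theta> (\<lambda>i. Y i \<omega>'))" 2] uM uN cos_le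
    by auto
  ultimately have eq1: "(LINT \<omega>|M. u (\<lambda>i. X i \<omega>) * (1 + cos (\<theta> (\<lambda>i. X i \<omega>))) * indicator (A l) (X l \<omega>))
      = (LINT \<omega>|N. u (\<lambda>i. Y i \<omega>) * (1 + cos (\<theta> (\<lambda>i. Y i \<omega>))) * indicator (A l) (Y l \<omega>))"
    using uM uN cos_le by (intro Levy_uniqueness_weighted[OF assms(1,2), where c=2]) auto
  have eq0: "(LINT \<omega>|M. u (\<lambda>i. X i \<omega>) * indicator (A l) (X l \<omega>)) = (LINT \<omega>|N. u (\<lambda>i. Y i \<omega>) * indicator (A l) (Y l \<omega>))"
    using uM uN IH0 by (intro Levy_uniqueness_weighted[OF assms(1,2), where c=1]) auto
  \<comment> \<open>The signed weight \<open>u * cos\<close> is a difference of the nonnegative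
    weights \<open>u * (1 + cos)\<close> and \<open>u\<close>, and the law of coordinate l under
    each of these has just been identified.\<close>
  have split: "indicator (A l) x * u z * cos r
      = u z * (1 + cos r) * indicator (A l) x - u z * indicator (A l) x"
    for z :: "'i \<Rightarrow> real" and x r by (simp add: algebra_simps)
  have bd: "\<bar>(1 + cos r) * indicator (A l) x\<bar> \<le> (2::real)" for r x
    using cos_le[of r] by (auto simp: indicator_def)
  have i1: "integrable M (\<lambda>\<omega>. u (\<lambda>i. X i \<omega>) * (1 + cos (\<theta> (\<lambda>i. X i \<omega>))) * indicator (A l) (X l \<omega>))"
  proof -
    have "integrable M (\<lambda>\<omega>. 2 * (u (\<lambda>i. X i \<omega>) * (((1 + cos (\<theta> (\<lambda>i. X i \<omega>))) * indicator (A l) (X l \<omega>)) / 2)))"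
      using bd by (intro integrable_mult_right iM) auto
    then show ?thesis by (simp add: mult_ac)
  qed
  have i2: "integrable N (\<lambda>\<omega>. u (\<lambda>i. Y i \<omega>) * (1 + cos (\<theta> (\<lambda>i. Y i \<omega>))) * indicator (A l) (Y l \<omega>))"
  proof -
    have "integrable N (\<lambda>\<omega>. 2 * (u (\<lambda>i. Y i \<omega>) * (((1 + cos (\<theta> (\<lambda>i. Y i \<omega>))) * indicator (A l) (Y l \<omega>)) / 2)))"
      using bd by (intro integrable_mult_right iN) auto
    then show ?thesis by (simp add: mult_ac)
  qed
  have "(LINT \<omega>|M. indicator (A l) (X l \<omega>) * u (\<lambda>i. X i \<omega>) * cos (\<theta> (\<lambda>i. X i \<omega>)))
      = (LINT \<omega>|N. indicator (A l) (Y l \<omega>) * u (\<lambda>i. Y i \<omega>) * cos (\<theta> (\<lambda>i. Y i \<omega>)))"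
    unfolding split
    by (subst (1 2) Bochner_Integration.integral_diff) (auto intro!: i1 i2 iM iN simp: eq0 eq1)
  then show ?case using l by (simp add: u_def \<theta>_def)
qed

text \<open>Localising every coordinate and taking the linear form to be 0 makes the preceding
  integrals the masses of rectangles, which determine a measure on the finite product.\<close>

lemma Cramer_Wold_cos:
  fixes X :: "'i \<Rightarrow> 'w \<Rightarrow> real" and Y :: "'i \<Rightarrow> 'v \<Rightarrow> real"
  assumes "prob_space M" "prob_space N"
    and [measurable]: "\<And>i. X i \<in> borel_measurable M" "\<And>i. Y i \<in> borel_measurable N"
    and "finite I"
    and eq: "\<And>a b. (LINT \<omega>|M. cos ((\<Sum>i\<in>I. a i * X i \<omega>) + b)) = (LINT \<omega>|N. cos ((\<Sum>i\<in>I. a i * Y i \<omega>) + b))"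
  shows "distr M (\<Pi>\<^sub>M i\<in>I. borel) (\<lambda>\<omega>. \<lambda>i\<in>I. X i \<omega>) = distr N (\<Pi>\<^sub>M i\<in>I. borel) (\<lambda>\<omega>. \<lambda>i\<in>I. Y i \<omega>)"
    (is "?P = ?Q")
proof (rule measure_eqI_PiM_finite[OF \<open>finite I\<close>])
  interpret M: prob_space M by fact
  interpret N: prob_space N by fact
  have rect: "emeasure (distr P (\<Pi>\<^sub>M i\<in>I. borel) (\<lambda>\<omega>. \<lambda>i\<in>I. Z i \<omega>)) (Pi\<^sub>E I A)
      = ennreal (LINT \<omega>|P. (\<Prod>i\<in>I. indicator (A i) (Z i \<omega>)))"
    if "prob_space P" and [measurable]: "\<And>i. Z i \<in> borel_measurable P" and A: "\<And>i. A i \<in> sets borel"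
    for P :: "'x measure" and Z and A :: "'i \<Rightarrow> real set"
  proof -
    interpret P: prob_space P by fact
    have [measurable]: "A i \<in> sets borel" for i by fact
    have S: "(\<lambda>\<omega>. \<lambda>i\<in>I. Z i \<omega>) -` Pi\<^sub>E I A \<inter> space P \<in> sets P"
      by (rule measurable_sets[where A="\<Pi>\<^sub>M i\<in>I. borel"]) (use \<open>finite I\<close> in auto)
    have "emeasure (distr P (\<Pi>\<^sub>M i\<in>I. borel) (\<lambda>\<omega>. \<lambda>i\<in>I. Z i \<omega>)) (Pi\<^sub>E I A)
        = emeasure P ((\<lambda>\<omega>. \<lambda>i\<in>I. Z i \<omega>) -` Pi\<^sub>E I A \<inter> space P)"
      by (subst emeasure_distr) (use \<open>finite I\<close> in auto)
    also have "\<dots> = ennreal (LINT \<omega>|P. indicator ((\<lambda>\<omega>. \<lambda>i\<in>I. Z i \<omega>) -` Pi\<^sub>E I A \<inter> space P) \<omega>)"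
      using S by (simp add: P.emeasure_eq_measure)
    also have "(LINT \<omega>|P. indicator ((\<lambda>\<omega>. \<lambda>i\<in>I. Z i \<omega>) -` Pi\<^sub>E I A \<inter> space P) \<omega>)
        = (LINT \<omega>|P. (\<Prod>i\<in>I. indicator (A i) (Z i \<omega>) :: real))"
      using \<open>finite I\<close> by (intro Bochner_Integration.integral_cong)
        (auto simp: indicator_def PiE_iff prod_zero_iff)
    finally show ?thesis .
  qed
  show "emeasure ?P (Pi\<^sub>E I A) = emeasure ?Q (Pi\<^sub>E I A)" if A: "\<And>i. i \<in> I \<Longrightarrow> A i \<in> sets borel" for A
  proof -
    \<comment> \<open>The comparison lemma asks for a Borel set at every index, whereas
      \<open>A\<close> is controlled on \<open>I\<close> only.\<close>
    define A' where "A' i = (if i \<in> I then A i else UNIV)" for i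
    have A': "A' i \<in> sets borel" for i using A by (simp add: A'_def)
    have "Pi\<^sub>E I A = Pi\<^sub>E I A'" by (auto simp: A'_def PiE_iff)
    then show ?thesis
      using rect[of M X, OF assms(1) assms(3) A'] rect[of N Y, OF assms(2) assms(4) A']
        integral_indicators_cos_eq[OF assms order_refl A', where a="\<lambda>_. 0" and b=0]
      by simp
  qed
  interpret P: prob_space ?P by (rule M.prob_space_distr) simp
  show "range (\<lambda>_::nat. Pi\<^sub>E I (\<lambda>_. UNIV)) \<subseteq> prod_algebra I (\<lambda>_. borel :: real measure)"
    using \<open>finite I\<close> by (auto intro!: prod_algebraI_finite)
  show "emeasure ?P (Pi\<^sub>E I (\<lambda>_. UNIV)) \<noteq> \<infinity>" using P.emeasure_finite by simp
qed (auto simp: space_PiM)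

lemma integral_cos_of_char:
  assumes "prob_space M" and [measurable]: "S \<in> borel_measurable M"
    and ch: "(LINT \<omega>|M. iexp (S \<omega>)) = complex_of_real c"
  shows "(LINT \<omega>|M. cos (S \<omega> + b)) = c * cos b"
proof -
  interpret prob_space M by fact
  have i: "integrable M (\<lambda>\<omega>. iexp b * iexp (S \<omega>))"
    by (intro integrable_mult_right integrable_iexp) auto
  have "(LINT \<omega>|M. cos (S \<omega> + b)) = (LINT \<omega>|M. Re (iexp b * iexp (S \<omega>)))"
    by (intro Bochner_Integration.integral_cong) (simp_all add: Re_exp Im_exp cos_add mult_ac)
  also have "\<dots> = Re (iexp b * (LINT \<omega>|M. iexp (S \<omega>)))"
    unfolding integral_Re[OF i] by simp
  finally show ?thesis unfolding ch by (simp add: Re_exp)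
qed

lemma std_normal_integral_cos:
  "(LINT x|std_normal_distribution. cos (c * x + b)) = exp (- c\<^sup>2 / 2) * cos b"
proof -
  interpret real_distribution std_normal_distribution by (rule real_dist_normal_dist)
  have "(CLINT x|std_normal_distribution. iexp (c * x)) = complex_of_real (exp (- c\<^sup>2 / 2))"
    using char_std_normal_distribution unfolding char_def by (simp add: fun_eq_iff)
  then show ?thesis by (intro integral_cos_of_char prob_space_axioms) auto
qed

text \<open>Integrating out the second variable first, S is constant and joins the phase; what
  remains is d times a cosine integral in S alone. So the characteristic functions multiply with no
  sine terms to track.\<close>

lemma integral_cos_pair:
  fixes S :: "'a \<Rightarrow> real" and T :: "'b \<Rightarrow> real"
  assumes "prob_space M" "prob_space N"
    and [measurable]: "S \<in> borel_measurable M" "T \<in> borel_measurable N"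
    and S: "\<And>b. (LINT \<omega>|M. cos (S \<omega> + b)) = c * cos b" and T: "\<And>b. (LINT \<omega>|N. cos (T \<omega> + b)) = d * cos b"
  shows "(LINT z|(M \<Otimes>\<^sub>M N). cos (S (fst z) + T (snd z) + b)) = c * d * cos b"
proof -
  interpret M: prob_space M by fact
  interpret N: prob_space N by fact
  interpret MN: pair_prob_space M N ..
  have i: "integrable (M \<Otimes>\<^sub>M N) (\<lambda>z. cos (S (fst z) + T (snd z) + b))"
    by (rule MN.P.integrable_const_bound[of _ 1]) auto
  have "(LINT z|(M \<Otimes>\<^sub>M N). cos (S (fst z) + T (snd z) + b))
      = (LINT x|M. LINT y|N. cos (T y + (S x + b)))"
    using MN.integral_fst'[OF i] by (simp add: add_ac)
  also have "\<dots> = c * d * cos b" unfolding T by (simp add: S)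
  finally show ?thesis .
qed

text \<open>Gaussian variables may be constant almost surely. In the centered case this is just
  variance 0, where the cosine formula still holds, so one formula in terms of the second moment
  covers both alternatives.\<close>

lemma gaussian_variable_centered:
  assumes "prob_space M" "gaussian_variable M S" and mean: "integral\<^sup>L M S = 0"
  shows "integrable M S" "integrable M (\<lambda>\<omega>. (S \<omega>)\<^sup>2)"
    and "(LINT \<omega>|M. cos (S \<omega> + b)) = exp (- (LINT \<omega>|M. (S \<omega>)\<^sup>2) / 2) * cos b"
    and "(LINT \<omega>|M. (S \<omega>)\<^sup>2) > 0 \<Longrightarrow>
      distr M borel (\<lambda>\<omega>. S \<omega> / sqrt (LINT \<omega>|M. (S \<omega>)\<^sup>2)) = std_normal_distribution"
proof -
  interpret prob_space M by fact
  have S [measurable]: "S \<in> borel_measurable M" using assms by (simp add: gaussian_variable_def)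
  consider \<mu> \<sigma> where "\<sigma> > 0" "distributed M lborel S (normal_density \<mu> \<sigma>)" | \<mu> where "AE \<omega> in M. S \<omega> = \<mu>"
    using assms(2) unfolding gaussian_variable_def by auto
  then have "integrable M S \<and> integrable M (\<lambda>\<omega>. (S \<omega>)\<^sup>2)
    \<and> (LINT \<omega>|M. cos (S \<omega> + b)) = exp (- (LINT \<omega>|M. (S \<omega>)\<^sup>2) / 2) * cos b
    \<and> ((LINT \<omega>|M. (S \<omega>)\<^sup>2) > 0 \<longrightarrow>
      distr M borel (\<lambda>\<omega>. S \<omega> / sqrt (LINT \<omega>|M. (S \<omega>)\<^sup>2)) = std_normal_distribution)"
  proof cases
    case 1
    have "\<mu> = 0" using normal_distributed_expectation[OF 1(1,2)] mean by simp
    then have "distributed M lborel (\<lambda>\<omega>. S \<omega> / \<sigma>) std_normal_density"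
      using 1 normal_standard_normal_convert[OF 1(1), of S \<mu>] by simp
    then have law: "distr M borel (\<lambda>\<omega>. S \<omega> / \<sigma>) = std_normal_distribution"
      using distributed_distr_eq_density[of M lborel "\<lambda>\<omega>. S \<omega> / \<sigma>"]
      by (simp cong: distr_cong)
    have int: "integrable M (\<lambda>\<omega>. (S \<omega> / \<sigma>) ^ k)" for k
      using integrable_std_normal_distribution_moment[of k] unfolding law[symmetric]
      by (subst (asm) integrable_distr_eq) auto
    have var: "(LINT \<omega>|M. (S \<omega>)\<^sup>2) = \<sigma>\<^sup>2"
      using normal_distributed_variance[OF 1(1,2)] mean by simp
    have "char (distr M borel (\<lambda>\<omega>. S \<omega> / \<sigma>)) \<sigma> = (LINT \<omega>|M. iexp (S \<omega>))"
      unfolding char_def using 1 by (subst integral_distr) auto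
    then have ch: "(LINT \<omega>|M. iexp (S \<omega>)) = exp (- \<sigma>\<^sup>2 / 2)"
      unfolding law by (simp add: char_std_normal_distribution)
    have c: "(LINT \<omega>|M. cos (S \<omega> + b)) = exp (- \<sigma>\<^sup>2 / 2) * cos b"
      using ch by (intro integral_cos_of_char prob_space_axioms) auto
    have "integrable M (\<lambda>\<omega>. \<sigma> * (S \<omega> / \<sigma>) ^ 1)" "integrable M (\<lambda>\<omega>. \<sigma>\<^sup>2 * (S \<omega> / \<sigma>) ^ 2)"
      using int by (intro integrable_mult_right; blast)+
    then have "integrable M S" "integrable M (\<lambda>\<omega>. (S \<omega>)\<^sup>2)"
      using 1 by (simp_all add: power_divide)
    then show ?thesis using c law 1 by (simp add: var)
  next
    case 2
    have "integral\<^sup>L M S = \<mu>" using 2 by (subst integral_cong_AE[of _ _ "\<lambda>_. \<mu>"]) (auto simp: prob_space)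
    with 2 mean have ae: "AE \<omega> in M. S \<omega> = 0" by simp
    have v: "(LINT \<omega>|M. (S \<omega>)\<^sup>2) = 0"
      using ae by (subst integral_cong_AE[of _ _ "\<lambda>_. 0"]) auto
    have "(LINT \<omega>|M. cos (S \<omega> + b)) = cos b"
      using ae by (subst integral_cong_AE[of _ _ "\<lambda>_. cos b"]) (auto simp: prob_space)
    moreover have "integrable M S" "integrable M (\<lambda>\<omega>. (S \<omega>)\<^sup>2)"
      using ae by (auto intro!: integrable_cong_AE_imp[of M "\<lambda>_. 0::real"])
    ultimately show ?thesis using v by simp
  qed
  then show "integrable M S" "integrable M (\<lambda>\<omega>. (S \<omega>)\<^sup>2)"
    "(LINT \<omega>|M. cos (S \<omega> + b)) = exp (- (LINT \<omega>|M. (S \<omega>)\<^sup>2) / 2) * cos b"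
    "(LINT \<omega>|M. (S \<omega>)\<^sup>2) > 0 \<Longrightarrow>
      distr M borel (\<lambda>\<omega>. S \<omega> / sqrt (LINT \<omega>|M. (S \<omega>)\<^sup>2)) = std_normal_distribution"
    by auto
qed

lemma integrable_mult_square:
  fixes f g :: "'a \<Rightarrow> real"
  assumes [measurable]: "f \<in> borel_measurable M" "g \<in> borel_measurable M"
    and "integrable M (\<lambda>x. (f x)\<^sup>2)" "integrable M (\<lambda>x. (g x)\<^sup>2)"
  shows "integrable M (\<lambda>x. f x * g x)"
proof (rule Bochner_Integration.integrable_bound[where f="\<lambda>x. (f x)\<^sup>2 + (g x)\<^sup>2"])
  have "\<bar>a * b\<bar> \<le> a\<^sup>2 + b\<^sup>2" for a b :: real
  proof -
    have "0 \<le> \<bar>a\<bar> * \<bar>b\<bar>" by simp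
    then show ?thesis using sum_squares_bound[of "\<bar>a\<bar>" "\<bar>b\<bar>"]
      by (simp only: abs_mult mult.assoc power2_abs)
  qed
  then show "AE x in M. norm (f x * g x) \<le> norm ((f x)\<^sup>2 + (g x)\<^sup>2)" by auto
qed (use assms in auto)

text \<open>The cosine formula is indexed through a map \<open>f\<close> so that one point may occur
  under several indices. Such repetitions arise for two points x and y that may coincide, and for
  the projections of points of the product space.\<close>

lemma gaussian_field_second_moments:
  fixes X :: "'x::ab_group_add \<Rightarrow> 'w \<Rightarrow> real"
  assumes M: "prob_space M" and G: "gaussian_field M X" and Z: "centered_field M X"
    and C: "has_covariance_function M X C"
  shows "X x \<in> borel_measurable M" "integrable M (X x)" "integrable M (\<lambda>\<omega>. (X x \<omega>)\<^sup>2)"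
    and "integrable M (\<lambda>\<omega>. X x \<omega> * X y \<omega>)" "(LINT \<omega>|M. X x \<omega> * X y \<omega>) = C (x - y)"
    and "finite I \<Longrightarrow> (LINT \<omega>|M. cos ((\<Sum>i\<in>I. a i * X (f i) \<omega>) + b))
      = exp (- (\<Sum>i\<in>I. \<Sum>j\<in>I. a i * a j * C (f i - f j)) / 2) * cos b"
proof -
  show m [measurable]: "X x \<in> borel_measurable M" for x using G by (simp add: gaussian_field_def)
  have g: "gaussian_variable M (\<lambda>\<omega>. \<Sum>x\<in>J. a x * X x \<omega>)" if "finite J" for J a
    using G that by (simp add: gaussian_field_def)
  have z: "integral\<^sup>L M (X x) = 0" for x using Z by (simp add: centered_field_def)
  show i1: "integrable M (X x)" and i2: "integrable M (\<lambda>\<omega>. (X x \<omega>)\<^sup>2)" for x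
    using gaussian_variable_centered(1,2)[OF M _ z[of x]] g[of "{x}" "\<lambda>_. 1"] by simp_all
  show i3: "integrable M (\<lambda>\<omega>. X x \<omega> * X y \<omega>)" for x y
    by (rule integrable_mult_square) (use i2 in auto)
  show e: "(LINT \<omega>|M. X x \<omega> * X y \<omega>) = C (x - y)" for x y
    using C by (simp add: has_covariance_function_def covariance_def z)
  assume "finite I"
  \<comment> \<open>Coefficients of equal points are collected first, since
    \<open>gaussian_field\<close> speaks of sums over sets of points.\<close>
  have "(\<Sum>i\<in>I. a i * X (f i) \<omega>) = (\<Sum>x\<in>f ` I. (\<Sum>i\<in>{i\<in>I. f i = x}. a i) * X x \<omega>)" for \<omega>
    unfolding sum.image_gen[OF \<open>finite I\<close>, of "\<lambda>i. a i * X (f i) \<omega>" f] sum_distrib_right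
    by (intro sum.cong) auto
  then have gI: "gaussian_variable M (\<lambda>\<omega>. \<Sum>i\<in>I. a i * X (f i) \<omega>)"
    using g[of "f ` I"] \<open>finite I\<close> by simp
  have "(LINT \<omega>|M. (\<Sum>i\<in>I. a i * X (f i) \<omega>)) = 0"
    by (subst Bochner_Integration.integral_sum) (auto simp: z intro: i1)
  moreover have "(LINT \<omega>|M. (\<Sum>i\<in>I. a i * X (f i) \<omega>)\<^sup>2)
      = (LINT \<omega>|M. (\<Sum>i\<in>I. \<Sum>j\<in>I. (a i * a j) * (X (f i) \<omega> * X (f j) \<omega>)))"
    by (simp add: power2_eq_square sum_product mult_ac)
  moreover have "\<dots> = (\<Sum>i\<in>I. \<Sum>j\<in>I. a i * a j * C (f i - f j))"
    by (subst Bochner_Integration.integral_sum, (auto intro!: i3)[1])+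
       (simp add: i3 e)
  ultimately show "(LINT \<omega>|M. cos ((\<Sum>i\<in>I. a i * X (f i) \<omega>) + b))
      = exp (- (\<Sum>i\<in>I. \<Sum>j\<in>I. a i * a j * C (f i - f j)) / 2) * cos b"
    using gaussian_variable_centered(3)[OF M gI, of b] by simp
qed

lemma integral_pair_product:
  fixes f :: "'a \<Rightarrow> real" and g :: "'b \<Rightarrow> real"
  assumes "sigma_finite_measure M" "sigma_finite_measure N" and f: "integrable M f" and g: "integrable N g"
  shows "integrable (M \<Otimes>\<^sub>M N) (\<lambda>z. f (fst z) * g (snd z))"
    and "(LINT z|(M \<Otimes>\<^sub>M N). f (fst z) * g (snd z)) = integral\<^sup>L M f * integral\<^sup>L N g"
proof -
  interpret pair_sigma_finite M N using assms by (simp add: pair_sigma_finite_def)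
  note [measurable] = borel_measurable_integrable[OF f] borel_measurable_integrable[OF g]
  show i: "integrable (M \<Otimes>\<^sub>M N) (\<lambda>z. f (fst z) * g (snd z))"
    by (rule Fubini_integrable) (use f g in \<open>auto simp: abs_mult\<close>)
  show "(LINT z|(M \<Otimes>\<^sub>M N). f (fst z) * g (snd z)) = integral\<^sup>L M f * integral\<^sup>L N g"
    using integral_fst'[OF i] by simp
qed

text \<open>The normalised pair has the law of (G1, r G1 + s G2) with G1, G2 independent standard
  normal. Expanding H_k(r G1 + s G2) by the addition formula, every term containing H_(k-j)(G2) with
  j < k has mean zero, so only r^k E H_k(G1)^2 survives.\<close>

lemma gaussian_field_hermite:
  fixes X :: "'x::ab_group_add \<Rightarrow> 'w \<Rightarrow> real"
  assumes M: "prob_space M" and G: "gaussian_field M X" and Z: "centered_field M X"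
    and C: "has_covariance_function M X C" and pos: "C 0 > 0"
  shows "integrable M (\<lambda>\<omega>. hermite k (X x \<omega> / sqrt (C 0)))"
    and "integrable M (\<lambda>\<omega>. (hermite k (X x \<omega> / sqrt (C 0)))\<^sup>2)"
    and "k > 0 \<Longrightarrow> (LINT \<omega>|M. hermite k (X x \<omega> / sqrt (C 0))) = 0"
    and "(LINT \<omega>|M. hermite k (X x \<omega> / sqrt (C 0)) * hermite k (X y \<omega> / sqrt (C 0)))
      = fact k * (C (x - y) / C 0) ^ k"
proof -
  interpret prob_space M by fact
  note sm = gaussian_field_second_moments[OF M G Z C]
  note [measurable] = sm(1)
  have sq: "(LINT \<omega>|M. (X x \<omega>)\<^sup>2) = C 0" for x using sm(5)[of x x] by (simp add: power2_eq_square)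
  have "gaussian_variable M (X x)" for x
    using G[unfolded gaussian_field_def, THEN conjunct2, rule_format, of "{x}" "\<lambda>_. 1"] by simp
  then have law: "distr M borel (\<lambda>\<omega>. X x \<omega> / sqrt (C 0)) = std_normal_distribution" for x
    using gaussian_variable_centered(4)[OF M, of "X x"] Z pos by (simp add: sq centered_field_def)
  note std = integrable_std_normal_hermite[of k, folded law[of x]]
  show "integrable M (\<lambda>\<omega>. hermite k (X x \<omega> / sqrt (C 0)))"
    and "integrable M (\<lambda>\<omega>. (hermite k (X x \<omega> / sqrt (C 0)))\<^sup>2)"
    by (rule integrable_distr[OF _ std(1)], measurable) (rule integrable_distr[OF _ std(2)], measurable)
  show "(LINT \<omega>|M. hermite k (X x \<omega> / sqrt (C 0))) = 0" if "k > 0"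
    using std_normal_hermite_integral[OF that, folded law[of x]] by (subst (asm) integral_distr) auto
  define r where "r = C (x - y) / C 0"
  define s where "s = sqrt (1 - r\<^sup>2)"
  \<comment> \<open>The values 1 and -1 of \<epsilon> give |r| \<le> 1, which makes \<open>s\<close>
    a genuine square root.\<close>
  have "0 \<le> (LINT \<omega>|M. (X x \<omega> + \<epsilon> * X y \<omega>)\<^sup>2)" for \<epsilon>
    by (intro Bochner_Integration.integral_nonneg) auto
  moreover have "(LINT \<omega>|M. (X x \<omega> + \<epsilon> * X y \<omega>)\<^sup>2) = C 0 + \<epsilon>\<^sup>2 * C 0 + 2 * \<epsilon> * C (x - y)" for \<epsilon>
  proof -
    have "(LINT \<omega>|M. (X x \<omega> + \<epsilon> * X y \<omega>)\<^sup>2)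
        = (LINT \<omega>|M. (X x \<omega>)\<^sup>2 + \<epsilon>\<^sup>2 * (X y \<omega>)\<^sup>2 + 2 * \<epsilon> * (X x \<omega> * X y \<omega>))"
      by (intro Bochner_Integration.integral_cong) (auto simp: power2_eq_square algebra_simps)
    then show ?thesis by (simp add: sm sq)
  qed
  ultimately have "0 \<le> C 0 + \<epsilon>\<^sup>2 * C 0 + 2 * \<epsilon> * C (x - y)" for \<epsilon> by simp
  from this[of 1] this[of "-1"] have "\<bar>r\<bar> \<le> 1" using pos by (auto simp: r_def abs_le_iff field_simps)
  then have "r\<^sup>2 \<le> 1" by (simp add: abs_square_le_1)
  then have rs: "r\<^sup>2 + s\<^sup>2 = 1" by (simp add: s_def)
  let ?G = "std_normal_distribution"
  let ?N = "?G \<Otimes>\<^sub>M ?G"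
  interpret G: real_distribution ?G by (rule real_dist_normal_dist)
  interpret GG: pair_prob_space ?G ?G ..
  define U where "U b \<omega> = (if b then X x \<omega> else X y \<omega>) / sqrt (C 0)" for b \<omega>
  define V where "V b z = (if b then fst z else r * fst z + s * snd z)" for b and z :: "real \<times> real"
  have [measurable]: "U b \<in> borel_measurable M" for b unfolding U_def by (cases b) auto
  have [measurable]: "fst \<in> borel_measurable ?N" "snd \<in> borel_measurable ?N"
    using measurable_fst[of ?G ?G] measurable_snd[of ?G ?G] by (simp_all cong: measurable_cong_sets)
  have [measurable]: "V b \<in> borel_measurable ?N" for b unfolding V_def by (cases b) auto
  have "distr M (\<Pi>\<^sub>M i\<in>UNIV. borel) (\<lambda>\<omega>. \<lambda>i\<in>UNIV. U i \<omega>) = distr ?N (\<Pi>\<^sub>M i\<in>UNIV. borel) (\<lambda>\<omega>. \<lambda>i\<in>UNIV. V i \<omega>)"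
  proof (rule Cramer_Wold_cos)
    fix a :: "bool \<Rightarrow> real" and b
    let ?f = "\<lambda>b. if b then x else y"
    have "(LINT \<omega>|M. cos ((\<Sum>i\<in>UNIV. a i * U i \<omega>) + b))
        = (LINT \<omega>|M. cos ((\<Sum>i\<in>UNIV. a i / sqrt (C 0) * X (?f i) \<omega>) + b))"
      by (simp add: U_def UNIV_bool)
    also have "\<dots> = exp (- (\<Sum>i\<in>UNIV. \<Sum>j\<in>UNIV. a i / sqrt (C 0) * (a j / sqrt (C 0)) * C (?f i - ?f j)) / 2) * cos b"
      by (rule sm(6)) simp
    also have "(\<Sum>i\<in>UNIV. \<Sum>j\<in>UNIV. a i / sqrt (C 0) * (a j / sqrt (C 0)) * C (?f i - ?f j))
        = (a True)\<^sup>2 + (a False)\<^sup>2 + 2 * a True * a False * r"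
    proof -
      have "C (y - x) = C (x - y)" using sm(5)[of x y] sm(5)[of y x] by (simp add: mult.commute)
      moreover have "a i / sqrt (C 0) * (a j / sqrt (C 0)) * w = a i * a j * w / C 0" for i j w
        using pos by simp
      ultimately show ?thesis using pos by (simp add: UNIV_bool r_def power2_eq_square field_simps)
    qed
    \<comment> \<open>Completing the square diagonalises the covariance form, so the exponential
      factors over the two independent normals.\<close>
    also have "(a True)\<^sup>2 + (a False)\<^sup>2 + 2 * a True * a False * r = (a True + a False * r)\<^sup>2 + (a False * s)\<^sup>2"
    proof -
      have "(a True + a False * r)\<^sup>2 + (a False * s)\<^sup>2 = (a True)\<^sup>2 + (a False)\<^sup>2 * (r\<^sup>2 + s\<^sup>2) + 2 * a True * a False * r"
        by (simp add: power2_eq_square algebra_simps)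
      then show ?thesis using rs by simp
    qed
    also have "exp (- ((a True + a False * r)\<^sup>2 + (a False * s)\<^sup>2) / 2) * cos b
        = exp (- (a True + a False * r)\<^sup>2 / 2) * exp (- (a False * s)\<^sup>2 / 2) * cos b"
      by (simp flip: exp_add add: add_divide_distrib diff_divide_distrib)
    also have "\<dots> = (LINT z|?N. cos ((a True + a False * r) * fst z + (a False * s) * snd z + b))"
      by (rule integral_cos_pair[symmetric]) (auto simp: std_normal_integral_cos intro: G.prob_space_axioms)
    also have "\<dots> = (LINT z|?N. cos ((\<Sum>i\<in>UNIV. a i * V i z) + b))"
      by (simp add: V_def UNIV_bool algebra_simps)
    finally show "(LINT \<omega>|M. cos ((\<Sum>i\<in>UNIV. a i * U i \<omega>) + b)) = (LINT z|?N. cos ((\<Sum>i\<in>UNIV. a i * V i z) + b))" .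
  qed (auto intro: prob_space_axioms GG.P.prob_space_axioms)
  note eq = arg_cong[OF this, of "\<lambda>P. LINT z|P. hermite k (z True) * hermite k (z False)"]
  have meas: "(\<lambda>z. hermite k (z True) * hermite k (z False)) \<in> borel_measurable (\<Pi>\<^sub>M i\<in>UNIV. borel)"
    by measurable
  have "(LINT \<omega>|M. hermite k (U True \<omega>) * hermite k (U False \<omega>))
      = (LINT z|?N. hermite k (V True z) * hermite k (V False z))"
    using eq by (subst (asm) (1 2) integral_distr) (auto intro: meas)
  also have "\<dots> = (LINT z|?N. (\<Sum>j\<le>k. real (k choose j) * (r ^ j * s ^ (k - j)) *
      ((hermite k (fst z) * hermite j (fst z)) * hermite (k - j) (snd z))))"
    by (simp add: V_def hermite_add[OF rs] sum_distrib_left mult_ac)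
  also have "\<dots> = (\<Sum>j\<le>k. real (k choose j) * (r ^ j * s ^ (k - j)) *
      ((LINT u|?G. hermite k u * hermite j u) * (LINT v|?G. hermite (k - j) v)))"
  proof -
    have "integrable ?G (\<lambda>u. hermite k u * hermite j u)" for j
      by (rule integrable_mult_square) (auto intro: integrable_std_normal_hermite)
    note pp = integral_pair_product[OF G.sigma_finite_measure_axioms G.sigma_finite_measure_axioms
        this integrable_std_normal_hermite(1)]
    show ?thesis by (subst Bochner_Integration.integral_sum) (auto simp: pp intro!: integrable_mult_right)
  qed
  also have "\<dots> = (\<Sum>j\<le>k. if j = k then fact k * r ^ k else 0)"
  proof (rule sum.cong)
    fix j assume "j \<in> {..k}"
    moreover have "(LINT u|?G. hermite k u * hermite k u) = fact k"
      using std_normal_hermite_square[of k] by (simp add: power2_eq_square)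
    ultimately show "real (k choose j) * (r ^ j * s ^ (k - j)) *
      ((LINT u|?G. hermite k u * hermite j u) * (LINT v|?G. hermite (k - j) v)) = (if j = k then fact k * r ^ k else 0)"
      using std_normal_hermite_integral[of "k - j"] G.prob_space by (cases "j = k") auto
  qed simp
  finally show "(LINT \<omega>|M. hermite k (X x \<omega> / sqrt (C 0)) * hermite k (X y \<omega> / sqrt (C 0)))
      = fact k * (C (x - y) / C 0) ^ k"
    by (simp add: U_def r_def)
qed

section \<open>Integrals of paths\<close>

text \<open>Sampling a path at \<open>s i x\<close> involves finitely many points, and the norm
  bound keeps all sample points in one ball when the space of L is bounded.\<close>

lemma bounded_simple_approximation:
  fixes L :: "'x::euclidean_space measure"
  assumes id: "(\<lambda>x. x) \<in> borel_measurable L"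
  obtains s where "\<And>i::nat. simple_function L (s i)" "\<And>x. x \<in> space L \<Longrightarrow> (\<lambda>i. s i x) \<longlonglongrightarrow> x"
    "\<And>i x. x \<in> space L \<Longrightarrow> norm (s i x) \<le> 2 * norm x"
  using borel_measurable_implies_sequence_metric[OF id, of 0]
  by (clarsimp simp: dist_norm) blast

text \<open>Sampled at a simple function, the field is a finite choice among measurable variables;
  continuity of paths carries joint measurability to the limit.\<close>

lemma continuous_field_jointly_measurable:
  fixes X :: "'x::euclidean_space \<Rightarrow> 'w \<Rightarrow> real"
  assumes id: "(\<lambda>x. x) \<in> borel_measurable L"
    and X: "\<And>x. X x \<in> borel_measurable M" and cont: "continuous_field M X"
  shows "(\<lambda>z. X (fst z) (snd z)) \<in> borel_measurable (L \<Otimes>\<^sub>M M)"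
proof -
  obtain s where s: "\<And>i::nat. simple_function L (s i)" "\<And>x. x \<in> space L \<Longrightarrow> (\<lambda>i. s i x) \<longlonglongrightarrow> x"
    using bounded_simple_approximation[OF id] by metis
  show ?thesis
  proof (rule borel_measurable_LIMSEQ_metric)
    fix i
    have fin: "finite (s i ` space L)" using s(1) by (simp add: simple_function_def)
    have "s i \<in> measurable L (count_space (s i ` space L))"
      unfolding measurable_count_space_eq_countable[OF countable_finite[OF fin]]
      using simple_functionD(2)[OF s(1)] by blast
    then have s': "(\<lambda>z. s i (fst z)) \<in> measurable (L \<Otimes>\<^sub>M M) (count_space (s i ` space L))"
      by (rule measurable_compose[OF measurable_fst])
    show "(\<lambda>z. X (s i (fst z)) (snd z)) \<in> borel_measurable (L \<Otimes>\<^sub>M M)"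
      by (rule measurable_compose_countable'[where f="\<lambda>y z. X y (snd z)" and g="\<lambda>z. s i (fst z)",
            OF measurable_compose[OF measurable_snd X] s' countable_finite[OF fin]])
  next
    fix z assume z: "z \<in> space (L \<Otimes>\<^sub>M M)"
    then have "isCont (\<lambda>x. X x (snd z)) (fst z)"
      using cont by (auto simp: continuous_field_def space_pair_measure continuous_on_eq_continuous_at)
    then show "(\<lambda>i. X (s i (fst z)) (snd z)) \<longlonglongrightarrow> X (fst z) (snd z)"
      by (rule isCont_tendsto_compose) (use s(2)[of "fst z"] z in \<open>simp add: space_pair_measure mem_Times_iff\<close>)
  qed
qed

lemma integrable_continuous_bounded_space:
  fixes L :: "'x::euclidean_space measure" and h :: "'x \<Rightarrow> real"
  assumes "finite_measure L" and id: "(\<lambda>x. x) \<in> borel_measurable L" and "bounded (space L)"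
    and h: "continuous_on UNIV h"
  shows "integrable L h"
proof -
  interpret finite_measure L by fact
  have "compact (closure (space L))" using \<open>bounded (space L)\<close> by (simp add: compact_closure)
  then have "compact (h ` closure (space L))"
    by (rule compact_continuous_image[OF continuous_on_subset[OF h subset_UNIV]])
  then obtain b where b: "\<And>x. x \<in> closure (space L) \<Longrightarrow> \<bar>h x\<bar> \<le> b"
    by (metis bounded_real compact_imp_bounded imageI)
  have "h \<in> borel_measurable L"
    using measurable_compose[OF id borel_measurable_continuous_onI[OF h]] by simp
  moreover have "AE x in L. norm (h x) \<le> b"
    using b closure_subset[of "space L"] by (intro AE_I2) auto
  ultimately show ?thesis by (intro integrable_const_bound)
qed

text \<open>The integral is the pointwise limit of the sums \<Phi>, each depending on finitely many
  coordinates. Their characteristic functions agree by equality of the finite-dimensional laws,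
  hence so do the limits.\<close>

lemma distr_path_integral_eq:
  fixes X :: "'x::euclidean_space \<Rightarrow> 'w \<Rightarrow> real" and Y :: "'x \<Rightarrow> 'v \<Rightarrow> real" and g :: "real \<Rightarrow> real"
  assumes M: "prob_space M" and N: "prob_space N"
    and X: "\<And>x. X x \<in> borel_measurable M" "continuous_field M X"
    and Y: "\<And>x. Y x \<in> borel_measurable N" "continuous_field N Y"
    and eq: "\<And>I a b. finite I \<Longrightarrow>
      (LINT \<omega>|M. cos ((\<Sum>i\<in>I. a i * X i \<omega>) + b)) = (LINT \<omega>|N. cos ((\<Sum>i\<in>I. a i * Y i \<omega>) + b))"
    and L: "finite_measure L" "(\<lambda>x. x) \<in> borel_measurable L" "bounded (space L)"
    and g: "continuous_on UNIV g"
  shows "distr M borel (\<lambda>\<omega>. LINT x|L. g (X x \<omega>)) = distr N borel (\<lambda>\<omega>. LINT x|L. g (Y x \<omega>))"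
proof -
  interpret L: finite_measure L by fact
  obtain s where s: "\<And>i::nat. simple_function L (s i)" "\<And>x. x \<in> space L \<Longrightarrow> (\<lambda>i. s i x) \<longlonglongrightarrow> x"
    "\<And>i x. x \<in> space L \<Longrightarrow> norm (s i x) \<le> 2 * norm x"
    using bounded_simple_approximation[OF L(2)] by metis
  obtain R where R: "\<And>x. x \<in> space L \<Longrightarrow> norm x \<le> R" using L(3) by (auto simp: bounded_iff)
  define J where "J n = s n ` space L" for n
  define w where "w n y = measure L (s n -` {y} \<inter> space L)" for n y
  define \<Phi> where "\<Phi> n z = (\<Sum>y\<in>J n. w n y * g (z y))" for n and z :: "'x \<Rightarrow> real"
  have J: "finite (J n)" for n using s(1) by (simp add: J_def simple_function_def)
  have gm [measurable]: "g \<in> borel_measurable borel" by (rule borel_measurable_continuous_onI[OF g])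
  have lim: "(\<lambda>n. \<Phi> n (\<lambda>y. Z y \<omega>)) \<longlonglongrightarrow> (LINT x|L. g (Z x \<omega>))"
    if Z: "continuous_field P Z" and \<omega>: "\<omega> \<in> space P" for P :: "'p measure" and Z and \<omega>
  proof -
    have c: "continuous_on UNIV (\<lambda>x. g (Z x \<omega>))"
      using Z \<omega> continuous_on_compose[of UNIV "\<lambda>x. Z x \<omega>" g] continuous_on_subset[OF g subset_UNIV]
      by (auto simp: continuous_field_def comp_def)
    \<comment> \<open>The sample points may leave the space of L, but their norms are at most twice
      those of the approximated points; this fixes the radius \<open>2 * R\<close> of the dominating
      bound.\<close>
    have "compact ((\<lambda>x. g (Z x \<omega>)) ` cball 0 (2 * R))"
      by (intro compact_continuous_image continuous_on_subset[OF c]) auto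
    then obtain b where b: "\<And>x. x \<in> cball 0 (2 * R) \<Longrightarrow> \<bar>g (Z x \<omega>)\<bar> \<le> b"
      by (metis bounded_real compact_imp_bounded imageI)
    have simple: "simple_function L (\<lambda>x. g (Z (s n x) \<omega>))" for n
      using simple_function_compose[OF s(1)[of n], of "\<lambda>y. g (Z y \<omega>)"] by (simp add: comp_def)
    have "\<Phi> n (\<lambda>y. Z y \<omega>) = (LINT x|L. g (Z (s n x) \<omega>))" for n
    proof -
      have "(LINT x|L. g (Z (s n x) \<omega>)) = (LINT x|L. (\<Sum>y\<in>J n. indicator (s n -` {y} \<inter> space L) x * g (Z y \<omega>)))"
      proof (rule Bochner_Integration.integral_cong[OF refl])
        fix x assume "x \<in> space L"
        then have "(\<Sum>y\<in>J n. indicator (s n -` {y} \<inter> space L) x * g (Z y \<omega>))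
            = (\<Sum>y\<in>J n. if y = s n x then g (Z y \<omega>) else 0)"
          by (intro sum.cong) (auto simp: indicator_def)
        then show "g (Z (s n x) \<omega>) = (\<Sum>y\<in>J n. indicator (s n -` {y} \<inter> space L) x * g (Z y \<omega>))"
          using J[of n] \<open>x \<in> space L\<close> by (simp add: J_def)
      qed
      also have "\<dots> = (\<Sum>y\<in>J n. w n y * g (Z y \<omega>))"
      proof -
        have [measurable]: "s n -` {y} \<inter> space L \<in> sets L" for y
          by (rule simple_functionD(2)[OF s(1)])
        have "integrable L (\<lambda>x. indicator (s n -` {y} \<inter> space L) x * g (Z y \<omega>))" for y
          by (intro integrable_mult_left) (auto simp: L.emeasure_eq_measure)
        then show ?thesis
          by (subst Bochner_Integration.integral_sum) (auto simp: w_def Int_ac)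
      qed
      finally show ?thesis by (simp add: \<Phi>_def)
    qed
    moreover have "(\<lambda>n. LINT x|L. g (Z (s n x) \<omega>)) \<longlonglongrightarrow> (LINT x|L. g (Z x \<omega>))"
    proof (rule integral_dominated_convergence[where w="\<lambda>_. b"])
      show "(\<lambda>x. g (Z x \<omega>)) \<in> borel_measurable L"
        by (rule borel_measurable_integrable[OF integrable_continuous_bounded_space[OF L c]])
      show "(\<lambda>x. g (Z (s n x) \<omega>)) \<in> borel_measurable L" for n
        by (rule borel_measurable_simple_function[OF simple])
      show "integrable L (\<lambda>_. b)" by simp
      show "AE x in L. (\<lambda>n. g (Z (s n x) \<omega>)) \<longlonglongrightarrow> g (Z x \<omega>)"
        using c s(2) by (intro AE_I2 isCont_tendsto_compose[where g="\<lambda>x. g (Z x \<omega>)"])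
          (auto simp: continuous_on_eq_continuous_at)
      show "AE x in L. norm (g (Z (s n x) \<omega>)) \<le> b" for n
      proof (rule AE_I2)
        fix x assume "x \<in> space L"
        then have "norm (s n x) \<le> 2 * R" using s(3)[of x n] R[of x] by simp
        then show "norm (g (Z (s n x) \<omega>)) \<le> b" using b[of "s n x"] by simp
      qed
    qed
    ultimately show ?thesis by simp
  qed
  \<comment> \<open>Stated for a generic field because it is applied to X and to Y; the
    approximating sequence involves the field only through its finite-dimensional laws.\<close>
  have char_lim: "(\<lambda>n. LINT z|distr P (\<Pi>\<^sub>M i\<in>J n. borel) (\<lambda>\<omega>. \<lambda>i\<in>J n. Z i \<omega>). iexp (t * \<Phi> n z))
        \<longlonglongrightarrow> char (distr P borel (\<lambda>\<omega>. LINT x|L. g (Z x \<omega>))) t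
      \<and> (\<lambda>\<omega>. LINT x|L. g (Z x \<omega>)) \<in> borel_measurable P"
    if P: "prob_space P" and Z: "\<And>x. Z x \<in> borel_measurable P" "continuous_field P Z"
    for P :: "'p measure" and Z t
  proof -
    interpret P: prob_space P by fact
    note [measurable] = Z(1)
    have [measurable]: "(\<lambda>\<omega>. LINT x|L. g (Z x \<omega>)) \<in> borel_measurable P"
    proof (rule borel_measurable_LIMSEQ_real)
      show "(\<lambda>n. \<Phi> n (\<lambda>y. Z y \<omega>)) \<longlonglongrightarrow> (LINT x|L. g (Z x \<omega>))" if "\<omega> \<in> space P" for \<omega>
        by (rule lim[OF Z(2) that])
      show "(\<lambda>\<omega>. \<Phi> n (\<lambda>y. Z y \<omega>)) \<in> borel_measurable P" for n unfolding \<Phi>_def by measurable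
    qed
    have \<Phi>m: "\<Phi> n \<in> borel_measurable (\<Pi>\<^sub>M i\<in>J n. borel)" for n unfolding \<Phi>_def by measurable
    have "(LINT z|distr P (\<Pi>\<^sub>M i\<in>J n. borel) (\<lambda>\<omega>. \<lambda>i\<in>J n. Z i \<omega>). iexp (t * \<Phi> n z))
        = (LINT \<omega>|P. iexp (t * \<Phi> n (\<lambda>y. Z y \<omega>)))" for n
    proof -
      have "\<Phi> n (\<lambda>i\<in>J n. Z i \<omega>) = \<Phi> n (\<lambda>y. Z y \<omega>)" for \<omega> by (simp add: \<Phi>_def)
      then show ?thesis
        by (subst integral_distr) (use \<Phi>m in \<open>auto intro!: measurable_restrict\<close>)
    qed
    moreover have "(\<lambda>n. LINT \<omega>|P. iexp (t * \<Phi> n (\<lambda>y. Z y \<omega>))) \<longlonglongrightarrow> (LINT \<omega>|P. iexp (t * (LINT x|L. g (Z x \<omega>))))"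
    proof (rule integral_dominated_convergence[where w="\<lambda>_. 1"])
      show "(\<lambda>\<omega>. iexp (t * \<Phi> n (\<lambda>y. Z y \<omega>))) \<in> borel_measurable P" for n unfolding \<Phi>_def by measurable
      show "AE \<omega> in P. (\<lambda>n. iexp (t * \<Phi> n (\<lambda>y. Z y \<omega>))) \<longlonglongrightarrow> iexp (t * (LINT x|L. g (Z x \<omega>)))"
        by (intro AE_I2 isCont_tendsto_compose[OF isCont_iexp] tendsto_mult_left lim[OF Z(2)])
    qed auto
    moreover have "(LINT \<omega>|P. iexp (t * (LINT x|L. g (Z x \<omega>)))) = char (distr P borel (\<lambda>\<omega>. LINT x|L. g (Z x \<omega>))) t"
      unfolding char_def by (subst integral_distr) auto
    ultimately show ?thesis by simp
  qed
  interpret M: prob_space M by fact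
  interpret N: prob_space N by fact
  have fdd: "distr M (\<Pi>\<^sub>M i\<in>J n. borel) (\<lambda>\<omega>. \<lambda>i\<in>J n. X i \<omega>) = distr N (\<Pi>\<^sub>M i\<in>J n. borel) (\<lambda>\<omega>. \<lambda>i\<in>J n. Y i \<omega>)" for n
    by (rule Cramer_Wold_cos[OF M N X(1) Y(1) J eq[OF J]])
  note cX = char_lim[OF M X] and cY = char_lim[OF N Y]
  show ?thesis
  proof (rule Levy_uniqueness)
    show "char (distr M borel (\<lambda>\<omega>. LINT x|L. g (X x \<omega>))) = char (distr N borel (\<lambda>\<omega>. LINT x|L. g (Y x \<omega>)))"
      using LIMSEQ_unique[OF cX[THEN conjunct1, unfolded fdd] cY[THEN conjunct1]] by (rule ext)
  qed (use cX cY in \<open>auto simp: real_distribution_def real_distribution_axioms_def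
      intro: M.prob_space_distr N.prob_space_distr\<close>)
qed

section \<open>Moments of path integrals\<close>

lemma Fubini_bounded_sections:
  fixes f :: "'x \<times> 'w \<Rightarrow> real"
  assumes "finite_measure L" "sigma_finite_measure M" and f [measurable]: "f \<in> borel_measurable (L \<Otimes>\<^sub>M M)"
    and int: "\<And>x. x \<in> space L \<Longrightarrow> integrable M (\<lambda>\<omega>. f (x, \<omega>))"
    and bound: "\<And>x. x \<in> space L \<Longrightarrow> (LINT \<omega>|M. \<bar>f (x, \<omega>)\<bar>) \<le> c"
  shows "integrable (L \<Otimes>\<^sub>M M) f"
    and "integrable M (\<lambda>\<omega>. LINT x|L. f (x, \<omega>))"
    and "(LINT \<omega>|M. LINT x|L. f (x, \<omega>)) = (LINT x|L. LINT \<omega>|M. f (x, \<omega>))"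
proof -
  interpret L: finite_measure L by fact
  interpret M: sigma_finite_measure M by fact
  interpret pair_sigma_finite L M ..
  have "integrable L (\<lambda>x. LINT \<omega>|M. norm (f (x, \<omega>)))"
    by (rule L.integrable_const_bound[of _ c])
       (use bound in \<open>auto intro!: AE_I2 simp: Bochner_Integration.integral_nonneg\<close>)
  then show i: "integrable (L \<Otimes>\<^sub>M M) f"
    by (intro Fubini_integrable f) (use int in auto)
  have i': "integrable (L \<Otimes>\<^sub>M M) (case_prod (\<lambda>x \<omega>. f (x, \<omega>)))" using i by simp
  show "integrable M (\<lambda>\<omega>. LINT x|L. f (x, \<omega>))" by (rule integrable_snd[OF i'])
  show "(LINT \<omega>|M. LINT x|L. f (x, \<omega>)) = (LINT x|L. LINT \<omega>|M. f (x, \<omega>))"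
    by (rule Fubini_integral[OF i'])
qed

text \<open>The squared path integral is a double integral over
  \<open>L \<Otimes>\<^sub>M L\<close>. The uniform bound c on second moments bounds E |Z_x Z_y|,
  and on a finite measure this suffices for exchanging the integrals.\<close>

lemma integral_moments:
  fixes Z :: "'x \<Rightarrow> 'w \<Rightarrow> real"
  assumes L: "finite_measure L" and M: "prob_space M"
    and Z [measurable]: "(\<lambda>z. Z (fst z) (snd z)) \<in> borel_measurable (L \<Otimes>\<^sub>M M)"
    and int: "\<And>x. integrable M (\<lambda>\<omega>. (Z x \<omega>)\<^sup>2)" and bound: "\<And>x. (LINT \<omega>|M. (Z x \<omega>)\<^sup>2) \<le> c"
    and Zm [measurable]: "\<And>x. Z x \<in> borel_measurable M"
    and path: "\<And>\<omega>. \<omega> \<in> space M \<Longrightarrow> integrable L (\<lambda>x. Z x \<omega>)"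
  shows "(LINT \<omega>|M. LINT x|L. Z x \<omega>) = (LINT x|L. LINT \<omega>|M. Z x \<omega>)"
    and "integrable M (\<lambda>\<omega>. LINT x|L. Z x \<omega>)"
    and "integrable M (\<lambda>\<omega>. (LINT x|L. Z x \<omega>)\<^sup>2)"
    and "(LINT \<omega>|M. (LINT x|L. Z x \<omega>)\<^sup>2) = (LINT z|(L \<Otimes>\<^sub>M L). LINT \<omega>|M. Z (fst z) \<omega> * Z (snd z) \<omega>)"
proof -
  interpret L: finite_measure L by fact
  interpret M: prob_space M by fact
  interpret LL: pair_sigma_finite L L ..
  interpret LL': finite_measure "L \<Otimes>\<^sub>M L" by (rule finite_measure_pair_measure[OF L L])
  have i1: "integrable M (Z x)" for x
    using integrable_mult_square[of "Z x" M "\<lambda>_. 1"] int[of x] by simp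
  have i2: "integrable M (\<lambda>\<omega>. Z x \<omega> * Z y \<omega>)" for x y
    by (rule integrable_mult_square) (use int in auto)
  have "\<bar>u\<bar> \<le> u\<^sup>2 + 1" for u :: real
    using sum_squares_bound[of "\<bar>u\<bar>" 1] by simp
  then have b1: "(LINT \<omega>|M. \<bar>Z x \<omega>\<bar>) \<le> c + 1" for x
  proof -
    have "(LINT \<omega>|M. \<bar>Z x \<omega>\<bar>) \<le> (LINT \<omega>|M. (Z x \<omega>)\<^sup>2 + 1)"
      using int i1 \<open>\<And>u. \<bar>u\<bar> \<le> u\<^sup>2 + 1\<close> by (intro integral_mono) auto
    also have "\<dots> \<le> c + 1" using int bound by (simp add: M.prob_space)
    finally show ?thesis .
  qed
  have b2: "(LINT \<omega>|M. \<bar>Z x \<omega> * Z y \<omega>\<bar>) \<le> c" for x y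
  proof -
    have "\<bar>u * v\<bar> \<le> (u\<^sup>2 + v\<^sup>2) / 2" for u v :: real
      using sum_squares_bound[of "\<bar>u\<bar>" "\<bar>v\<bar>"] by (simp add: abs_mult)
    then have "(LINT \<omega>|M. \<bar>Z x \<omega> * Z y \<omega>\<bar>) \<le> (LINT \<omega>|M. ((Z x \<omega>)\<^sup>2 + (Z y \<omega>)\<^sup>2) / 2)"
      using int i2 by (intro integral_mono integrable_abs integrable_divide Bochner_Integration.integrable_add) auto
    also have "\<dots> \<le> c" using int bound[of x] bound[of y] by simp
    finally show ?thesis .
  qed
  note F1 = Fubini_bounded_sections[OF L M.sigma_finite_measure_axioms, of "\<lambda>z. Z (fst z) (snd z)" "c + 1"]
  show "(LINT \<omega>|M. LINT x|L. Z x \<omega>) = (LINT x|L. LINT \<omega>|M. Z x \<omega>)"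
    and "integrable M (\<lambda>\<omega>. LINT x|L. Z x \<omega>)"
    using F1(2,3) i1 b1 by simp_all
  have [measurable]: "(\<lambda>w. Z (fst (fst w)) (snd w)) \<in> borel_measurable ((L \<Otimes>\<^sub>M L) \<Otimes>\<^sub>M M)"
    using measurable_compose[of "\<lambda>w. (fst (fst w), snd w)" "(L \<Otimes>\<^sub>M L) \<Otimes>\<^sub>M M" "L \<Otimes>\<^sub>M M", OF _ Z] by simp
  have [measurable]: "(\<lambda>w. Z (snd (fst w)) (snd w)) \<in> borel_measurable ((L \<Otimes>\<^sub>M L) \<Otimes>\<^sub>M M)"
    using measurable_compose[of "\<lambda>w. (snd (fst w), snd w)" "(L \<Otimes>\<^sub>M L) \<Otimes>\<^sub>M M" "L \<Otimes>\<^sub>M M", OF _ Z] by simp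
  note F2 = Fubini_bounded_sections[OF LL'.finite_measure_axioms M.sigma_finite_measure_axioms,
      of "\<lambda>w. Z (fst (fst w)) (snd w) * Z (snd (fst w)) (snd w)" c]
  have sq: "(LINT z|(L \<Otimes>\<^sub>M L). Z (fst z) \<omega> * Z (snd z) \<omega>) = (LINT x|L. Z x \<omega>)\<^sup>2" if "\<omega> \<in> space M" for \<omega>
    using integral_pair_product(2)[OF L.sigma_finite_measure_axioms L.sigma_finite_measure_axioms path[OF that] path[OF that]]
    by (simp add: power2_eq_square)
  have "integrable M (\<lambda>\<omega>. LINT z|(L \<Otimes>\<^sub>M L). Z (fst z) \<omega> * Z (snd z) \<omega>)"
    using F2(2) i2 b2 by simp
  then show "integrable M (\<lambda>\<omega>. (LINT x|L. Z x \<omega>)\<^sup>2)"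
    by (rule Bochner_Integration.integrable_cong[THEN iffD1, rotated 2]) (simp_all add: sq)
  have "(LINT \<omega>|M. (LINT x|L. Z x \<omega>)\<^sup>2) = (LINT \<omega>|M. LINT z|(L \<Otimes>\<^sub>M L). Z (fst z) \<omega> * Z (snd z) \<omega>)"
    by (rule Bochner_Integration.integral_cong) (simp_all add: sq)
  also have "\<dots> = (LINT z|(L \<Otimes>\<^sub>M L). LINT \<omega>|M. Z (fst z) \<omega> * Z (snd z) \<omega>)"
    using F2(3) i2 b2 by simp
  finally show "(LINT \<omega>|M. (LINT x|L. Z x \<omega>)\<^sup>2) = (LINT z|(L \<Otimes>\<^sub>M L). LINT \<omega>|M. Z (fst z) \<omega> * Z (snd z) \<omega>)" .
qed

section \<open>Covariance functions\<close>

text \<open>Continuous paths give pointwise convergence but no immediate domination of second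
  moments. The bounded quantity E cos(X_x - X_0) = exp(C(x) - C(0)) is continuous by dominated
  convergence, and C is recovered by a logarithm.\<close>

lemma covariance_function_continuous:
  fixes X :: "'x::real_normed_vector \<Rightarrow> 'w \<Rightarrow> real"
  assumes M: "prob_space M" and G: "gaussian_field M X" and cont: "continuous_field M X"
    and Z: "centered_field M X" and C: "has_covariance_function M X C"
  shows "continuous_on UNIV C"
proof -
  interpret prob_space M by fact
  note sm = gaussian_field_second_moments[OF M G Z C]
  note [measurable] = sm(1)
  define \<phi> where "\<phi> x = (LINT \<omega>|M. cos (X x \<omega> - X 0 \<omega>))" for x
  have \<phi>: "\<phi> x = exp (C x - C 0)" for x
  proof -
    let ?a = "\<lambda>b. if b then 1 else - 1 :: real" and ?f = "\<lambda>b. if b then x else 0"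
    have "\<phi> x = (LINT \<omega>|M. cos ((\<Sum>b\<in>UNIV. ?a b * X (?f b) \<omega>) + 0))"
      by (simp add: \<phi>_def UNIV_bool)
    also have "\<dots> = exp (- (\<Sum>b\<in>UNIV. \<Sum>b'\<in>UNIV. ?a b * ?a b' * C (?f b - ?f b')) / 2) * cos 0"
      by (rule sm(6)) simp
    also have "(\<Sum>b\<in>UNIV. \<Sum>b'\<in>UNIV. ?a b * ?a b' * C (?f b - ?f b')) = 2 * (C 0 - C x)"
      using sm(5)[of x 0] sm(5)[of 0 x] by (simp add: UNIV_bool mult.commute)
    finally show ?thesis by simp
  qed
  have "continuous_on UNIV \<phi>"
  proof (rule continuous_on_sequentiallyI)
    fix u :: "nat \<Rightarrow> 'x" and a assume u: "u \<longlonglongrightarrow> a"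
    show "(\<lambda>n. \<phi> (u n)) \<longlonglongrightarrow> \<phi> a"
      unfolding \<phi>_def
    proof (rule integral_dominated_convergence[where w="\<lambda>_. 1"])
      have "(\<lambda>n. X (u n) \<omega>) \<longlonglongrightarrow> X a \<omega>" if "\<omega> \<in> space M" for \<omega>
        using cont that isCont_tendsto_compose[OF _ u, of "\<lambda>x. X x \<omega>"]
        by (auto simp: continuous_field_def continuous_on_eq_continuous_at)
      then show "AE \<omega> in M. (\<lambda>n. cos (X (u n) \<omega> - X 0 \<omega>)) \<longlonglongrightarrow> cos (X a \<omega> - X 0 \<omega>)"
        by (intro AE_I2 tendsto_cos tendsto_diff tendsto_const)
    qed auto
  qed
  then have "continuous_on UNIV (\<lambda>x. C 0 + ln (\<phi> x))"
    by (intro continuous_on_add continuous_on_const continuous_on_ln) (simp_all add: \<phi>)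
  then show ?thesis by (simp add: \<phi>)
qed

section \<open>Compact domains and means of powers of the covariance\<close>

lemma restrict_lborel_compact:
  fixes E :: "'x::euclidean_space set" and f :: "'x \<Rightarrow> real"
  assumes "compact E"
  shows "finite_measure (restrict_space lborel E)" "(\<lambda>x. x) \<in> borel_measurable (restrict_space lborel E)"
    "bounded (space (restrict_space lborel E))" "space (restrict_space lborel E) = E"
    "measure (restrict_space lborel E) E = measure lborel E"
    "(LINT x:E|lborel. f x) = (LINT x|restrict_space lborel E. f x)"
proof -
  have E: "E \<in> sets lborel" using assms by (simp add: borel_compact)
  show "space (restrict_space lborel E) = E" by (simp add: space_restrict_space)
  moreover show "finite_measure (restrict_space lborel E)"
    using emeasure_compact_finite[OF assms] E
    by (intro finite_measureI) (auto simp: space_restrict_space emeasure_restrict_space)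
  moreover show "(\<lambda>x. x) \<in> borel_measurable (restrict_space lborel E)"
    by (rule measurable_restrict_space1) simp
  ultimately show "bounded (space (restrict_space lborel E))"
    using compact_imp_bounded[OF assms] by simp
  show "measure (restrict_space lborel E) E = measure lborel E"
    using E by (intro measure_restrict_space) auto
  show "(LINT x:E|lborel. f x) = (LINT x|restrict_space lborel E. f x)"
    using E by (simp add: set_lebesgue_integral_def integral_restrict_space)
qed

lemma finite_measure_pair_bounded:
  fixes L1 :: "'x::euclidean_space measure" and L2 :: "'y::euclidean_space measure"
  assumes L1: "finite_measure L1" "(\<lambda>x. x) \<in> borel_measurable L1" "bounded (space L1)"
    and L2: "finite_measure L2" "(\<lambda>x. x) \<in> borel_measurable L2" "bounded (space L2)"
  shows "finite_measure (L1 \<Otimes>\<^sub>M L2)" "(\<lambda>z. z) \<in> borel_measurable (L1 \<Otimes>\<^sub>M L2)" "bounded (space (L1 \<Otimes>\<^sub>M L2))"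
proof -
  show "finite_measure (L1 \<Otimes>\<^sub>M L2)" by (rule finite_measure_pair_measure) fact+
  have "(\<lambda>z. (fst z, snd z)) \<in> borel_measurable (L1 \<Otimes>\<^sub>M L2)"
    by (intro borel_measurable_Pair measurable_compose[OF measurable_fst L1(2)] measurable_compose[OF measurable_snd L2(2)])
  then show "(\<lambda>z. z) \<in> borel_measurable (L1 \<Otimes>\<^sub>M L2)" by simp
  show "bounded (space (L1 \<Otimes>\<^sub>M L2))"
    using bounded_Times[OF L1(3) L2(3)] by (simp add: space_pair_measure)
qed

lemma set_integral_Times_compact:
  fixes f :: "'x::euclidean_space \<times> 'y::euclidean_space \<Rightarrow> real"
  assumes E1: "compact E1" and E2: "compact E2" and f: "continuous_on UNIV f"
  shows "(LINT z:(E1 \<times> E2)|lborel. f z)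
    = (LINT z|(restrict_space lborel E1 \<Otimes>\<^sub>M restrict_space lborel E2). f z)"
proof -
  let ?L1 = "restrict_space lborel E1" and ?L2 = "restrict_space lborel E2"
  note L1 = restrict_lborel_compact[OF E1] and L2 = restrict_lborel_compact[OF E2]
  interpret L1: finite_measure ?L1 by (rule L1)
  interpret L2: finite_measure ?L2 by (rule L2)
  interpret P: pair_sigma_finite ?L1 ?L2 ..
  have E: "compact (E1 \<times> E2)" using E1 E2 by (rule compact_Times)
  have "integrable lborel (\<lambda>z. indicator (E1 \<times> E2) z *\<^sub>R f z)"
    by (rule borel_integrable_compact[OF E continuous_on_subset[OF f subset_UNIV]])
  then have i: "integrable (lborel \<Otimes>\<^sub>M lborel) (\<lambda>z. indicator (E1 \<times> E2) z *\<^sub>R f z)" by (simp add: lborel_prod)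
  have "(LINT z:(E1 \<times> E2)|lborel. f z) = (LINT x|lborel. LINT y|lborel. indicator (E1 \<times> E2) (x, y) *\<^sub>R f (x, y))"
    using lborel_pair.integral_fst'[OF i] by (simp add: lborel_prod set_lebesgue_integral_def)
  also have "\<dots> = (LINT x:E1|lborel. LINT y:E2|lborel. f (x, y))"
    by (simp add: set_lebesgue_integral_def indicator_times mult.assoc)
  also have "\<dots> = (LINT x|?L1. LINT y|?L2. f (x, y))"
    by (simp only: L1(6) L2(6))
  also have "\<dots> = (LINT z|(?L1 \<Otimes>\<^sub>M ?L2). f z)"
    by (rule P.integral_fst', rule integrable_continuous_bounded_space[OF finite_measure_pair_bounded f])
       (rule L1 L2)+
  finally show ?thesis .
qed

lemma dilate_compact:
  fixes D :: "'x::euclidean_space set"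
  assumes D: "compact D" "measure lborel D > 0" and t: "t > 0"
  shows "compact (dilate t D)" "measure lborel (dilate t D) > 0"
proof -
  show c: "compact (dilate t D)" by (rule compact_scaling[OF D(1)])
  have "measure lebesgue ((\<lambda>x. t *\<^sub>R x + 0) ` D) = \<bar>t\<bar> ^ DIM('x) * measure lebesgue D"
    by (rule measure_lebesgue_affine)
  then have "measure lborel (dilate t D) = \<bar>t\<bar> ^ DIM('x) * measure lborel D"
    using c D(1) by (simp add: borel_compact)
  then show "measure lborel (dilate t D) > 0" using D t by simp
qed

text \<open>With b the q-th power mean of f, integrate y^k \<le> 1 + y^q at y = f / b: the two
  summands contribute equally, whence the factor 2. Jensen's inequality would give 1, but any
  constant suffices.\<close>

lemma mean_power_bound:
  fixes f :: "'a \<Rightarrow> real"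
  assumes "finite_measure P" and m: "measure P (space P) > 0" and nn: "\<And>z. 0 \<le> f z"
    and int: "\<And>k. integrable P (\<lambda>z. f z ^ k)" and kq: "k \<le> q" "q > 0"
    and pos: "(LINT z|P. f z ^ q) > 0"
  shows "(LINT z|P. f z ^ k) / measure P (space P)
    \<le> 2 * root q ((LINT z|P. f z ^ q) / measure P (space P)) ^ k"
proof -
  interpret finite_measure P by fact
  let ?m = "measure P (space P)"
  define b where "b = root q ((LINT z|P. f z ^ q) / ?m)"
  have b: "b > 0" using pos m kq by (simp add: b_def)
  have bq: "b ^ q = (LINT z|P. f z ^ q) / ?m"
    using pos m kq by (simp add: b_def less_imp_le)
  have pt: "f z ^ k \<le> b ^ k * (1 + f z ^ q / b ^ q)" for z
  proof -
    have "y ^ k \<le> 1 + y ^ q" if "y \<ge> 0" for y :: real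
    proof (cases "y \<le> 1")
      case True
      then show ?thesis using power_le_one[OF that True, of k] zero_le_power[OF that, of q] by simp
    next
      case False
      then have "y ^ k \<le> y ^ q" using kq(1) by (intro power_increasing) auto
      then show ?thesis by simp
    qed
    from this[of "f z / b"] show ?thesis using nn[of z] b by (simp add: power_divide field_simps)
  qed
  have "(LINT z|P. f z ^ k) \<le> (LINT z|P. b ^ k * (1 + f z ^ q / b ^ q))"
    using int pt by (intro integral_mono) auto
  also have "\<dots> = b ^ k * (?m + (LINT z|P. f z ^ q) / b ^ q)"
    using int by simp
  also have "\<dots> = 2 * b ^ k * ?m" using bq pos m by simp
  finally show ?thesis using m by (simp add: b_def field_simps)
qed

text \<open>The integrand exceeds (K(0)/2)^k near the diagonal and is nonnegative elsewhere, so a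
  small piece of E with positive volume, paired with itself, already contributes.\<close>

lemma covariance_integral_pos:
  fixes K :: "'x::euclidean_space \<Rightarrow> real"
  assumes E: "compact E" "measure lborel E > 0" and K: "continuous_on UNIV K" "K 0 > 0" "\<And>x. K x \<ge> 0"
  shows "(LINT z|(restrict_space lborel E \<Otimes>\<^sub>M restrict_space lborel E). K (fst z - snd z) ^ k) > 0"
proof -
  let ?L = "restrict_space lborel E"
  note L = restrict_lborel_compact[OF E(1)]
  interpret L: finite_measure ?L by (rule L)
  interpret LL: finite_measure "?L \<Otimes>\<^sub>M ?L" by (rule finite_measure_pair_bounded) (rule L)+
  have "isCont K 0" using K(1) by (simp add: continuous_on_eq_continuous_at)
  then have "\<forall>\<^sub>F x in at 0. K x > K 0 / 2"
    using K(2) by (intro order_tendstoD) (auto simp: isCont_def)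
  then obtain \<delta> where \<delta>: "\<delta> > 0" "\<And>x. x \<noteq> 0 \<Longrightarrow> norm x < \<delta> \<Longrightarrow> K x > K 0 / 2"
    by (auto simp: eventually_at dist_norm)
  have \<delta>': "K x > K 0 / 2" if "norm x < \<delta>" for x
    using \<delta>(2)[of x] that K(2) by (cases "x = 0") auto
  have Es: "E \<in> sets lborel" using E(1) by (simp add: borel_compact)
  \<comment> \<open>Finitely many balls of radius \<delta>/2 cover E; if each met it in a null set,
    E itself would be null.\<close>
  obtain c where c: "measure lborel (E \<inter> ball c (\<delta> / 2)) > 0"
  proof (rule ccontr)
    assume "\<not> thesis"
    with that have z: "\<And>c. \<not> measure lborel (E \<inter> ball c (\<delta> / 2)) > 0" by blast
    obtain S where S: "finite S" "E \<subseteq> (\<Union>c\<in>S. ball c (\<delta> / 2))"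
      using compactE_image[OF E(1), of UNIV "\<lambda>c. ball c (\<delta> / 2)"] \<delta>(1)
      by (metis (no_types, lifting) UNIV_I UN_iff centre_in_ball half_gt_zero_iff open_ball subsetI)
    have "E \<inter> ball c (\<delta> / 2) \<in> null_sets lborel" for c
    proof -
      \<comment> \<open>Finiteness is settled first, since \<open>measure\<close> also returns 0 on
        sets of infinite measure.\<close>
      have "emeasure lborel (E \<inter> ball c (\<delta> / 2)) \<le> emeasure lborel E"
        using Es by (intro emeasure_mono) auto
      then have "emeasure lborel (E \<inter> ball c (\<delta> / 2)) < \<infinity>"
        using emeasure_compact_finite[OF E(1)] by (simp add: order_le_less_trans)
      then show ?thesis
        using z[of c] Es by (auto simp: null_sets_def emeasure_eq_ennreal_measure not_less measure_le_0_iff)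
    qed
    then have "(\<Union>c\<in>S. E \<inter> ball c (\<delta> / 2)) \<in> null_sets lborel"
      using S(1) by (intro null_sets_UN') (auto simp: countable_finite)
    moreover have "(\<Union>c\<in>S. E \<inter> ball c (\<delta> / 2)) = E" using S(2) by auto
    ultimately show False using E(2) by (simp add: null_sets_def measure_def)
  qed
  define A where "A = E \<inter> ball c (\<delta> / 2)"
  have A: "A \<in> sets ?L" "A \<times> A \<in> sets (?L \<Otimes>\<^sub>M ?L)"
    using Es by (auto simp: A_def sets_restrict_space_iff)
  have "measure (?L \<Otimes>\<^sub>M ?L) (A \<times> A) = measure ?L A * measure ?L A"
    using A by (simp add: measure_def L.emeasure_pair_measure_Times enn2real_mult)
  moreover have "measure ?L A = measure lborel A" using Es by (intro measure_restrict_space) (auto simp: A_def)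
  ultimately have "measure (?L \<Otimes>\<^sub>M ?L) (A \<times> A) > 0" using c by (simp add: A_def)
  then have "0 < (K 0 / 2) ^ k * measure (?L \<Otimes>\<^sub>M ?L) (A \<times> A)" using K(2) by simp
  also have "\<dots> = (LINT z|(?L \<Otimes>\<^sub>M ?L). (K 0 / 2) ^ k * indicator (A \<times> A) z)"
    using A sets.sets_into_space[OF A(2)] by (simp add: Int_absorb2)
  also have "\<dots> \<le> (LINT z|(?L \<Otimes>\<^sub>M ?L). K (fst z - snd z) ^ k)"
  proof (rule integral_mono)
    show "integrable (?L \<Otimes>\<^sub>M ?L) (\<lambda>z. (K 0 / 2) ^ k * indicator (A \<times> A) z)"
      using A by (intro integrable_mult_right) (auto simp: LL.emeasure_eq_measure)
    have "continuous_on UNIV (\<lambda>z::'x \<times> 'x. K (fst z - snd z) ^ k)"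
      by (intro continuous_intros continuous_on_compose2[OF K(1)]) auto
    then show "integrable (?L \<Otimes>\<^sub>M ?L) (\<lambda>z. K (fst z - snd z) ^ k)"
      by (rule integrable_continuous_bounded_space[rotated 3]) (rule finite_measure_pair_bounded; rule L)+
    show "(K 0 / 2) ^ k * indicator (A \<times> A) z \<le> K (fst z - snd z) ^ k" for z
    proof (cases "z \<in> A \<times> A")
      case True
      then have "dist (fst z) c < \<delta> / 2" "dist (snd z) c < \<delta> / 2"
        by (auto simp: A_def dist_commute)
      then have "norm (fst z - snd z) < \<delta>"
        using dist_triangle_half_r[of c "fst z" \<delta> "snd z"] by (simp add: dist_commute dist_norm)
      then show ?thesis using \<delta>'[of "fst z - snd z"] K(2) True by (auto intro!: power_mono)
    next
      case False
      then show ?thesis using K(3) by simp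
    qed
  qed
  finally show ?thesis .
qed

lemma gamma_ratio_eq:
  fixes K :: "'x::euclidean_space \<Rightarrow> real"
  assumes "compact (dilate t D)" "continuous_on UNIV K"
  shows "gamma_ratio K D q t = (LINT z|(restrict_space lborel (dilate t D) \<Otimes>\<^sub>M restrict_space lborel (dilate t D)).
    K (fst z - snd z) ^ q) / (measure lborel (dilate t D))\<^sup>2"
proof -
  have "continuous_on UNIV (\<lambda>z::'x \<times> 'x. K (fst z - snd z) ^ q)"
    by (intro continuous_intros continuous_on_compose2[OF assms(2)]) auto
  from set_integral_Times_compact[OF assms(1,1) this] show ?thesis by (simp add: gamma_ratio_def)
qed

lemma gamma_ratio_pos:
  fixes K :: "'x::euclidean_space \<Rightarrow> real"
  assumes D: "compact D" "measure lborel D > 0" and t: "t > 0"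
    and K: "continuous_on UNIV K" "K 0 > 0" "\<And>x. K x \<ge> 0"
  shows "gamma_ratio K D q t > 0"
  using gamma_ratio_eq[OF dilate_compact(1)[OF D t] K(1)] dilate_compact[OF D t]
    covariance_integral_pos[OF dilate_compact[OF D t] K]
  by simp

lemma gamma_ratio_le:
  fixes K :: "'x::euclidean_space \<Rightarrow> real"
  assumes D: "compact D" "measure lborel D > 0" and t: "t > 0"
    and K: "continuous_on UNIV K" "K 0 > 0" "\<And>x. K x \<ge> 0" and kq: "k \<le> q" "q > 0"
  shows "gamma_ratio K D k t \<le> 2 * root q (gamma_ratio K D q t) ^ k"
proof -
  let ?E = "dilate t D" let ?L = "restrict_space lborel ?E"
  note E = dilate_compact[OF D t]
  note L = restrict_lborel_compact[OF E(1)]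
  interpret L: finite_measure ?L by (rule L)
  have m: "measure (?L \<Otimes>\<^sub>M ?L) (space (?L \<Otimes>\<^sub>M ?L)) = (measure lborel ?E)\<^sup>2"
    using L.emeasure_pair_measure_Times[of ?E ?L ?E] sets.top[of ?L] L(4,5)
    by (simp add: space_pair_measure measure_def enn2real_mult power2_eq_square)
  have "continuous_on UNIV (\<lambda>z::'x \<times> 'x. K (fst z - snd z) ^ k)" for k
    by (intro continuous_intros continuous_on_compose2[OF K(1)]) auto
  then have int: "integrable (?L \<Otimes>\<^sub>M ?L) (\<lambda>z. K (fst z - snd z) ^ k)" for k
    by (rule integrable_continuous_bounded_space[rotated 3]) (rule finite_measure_pair_bounded; rule L)+
  show ?thesis
    unfolding gamma_ratio_eq[OF E(1) K(1)] m[symmetric]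
    by (rule mean_power_bound[where f="\<lambda>z. K (fst z - snd z)", OF finite_measure_pair_bounded(1)[OF L(1-3) L(1-3)] _ K(3) int kq])
       (use E covariance_integral_pos[OF E K] in \<open>simp_all only: m zero_less_power\<close>)
qed

section \<open>Standardized perturbations\<close>

text \<open>Slutsky's argument directly on distribution functions, which works for any filter: {Z
  \<le> x} lies in {X \<le> x + \<delta>} together with {|X - Z| \<ge> \<delta>}, and similarly from
  below. The thirds of e pay for continuity of the limit, convergence of X, and Markov's inequality.
  Continuity of the limit is assumed everywhere because convergence of X is used at the shifted
  points.\<close>

lemma converges_in_distribution_L2_close:
  assumes N: "prob_space N"
    and cont: "\<And>x. isCont (cdf \<mu>) x"
    and meas [measurable]: "\<And>t. X t \<in> borel_measurable N" "\<And>t. Z t \<in> borel_measurable N"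
    and int: "\<forall>\<^sub>F t in F. integrable N (\<lambda>\<omega>. (X t \<omega> - Z t \<omega>)\<^sup>2)"
    and lim: "((\<lambda>t. LINT \<omega>|N. (X t \<omega> - Z t \<omega>)\<^sup>2) \<longlongrightarrow> 0) F"
    and conv: "converges_in_distribution N X \<mu> F"
  shows "converges_in_distribution N Z \<mu> F"
  unfolding converges_in_distribution_def
proof (intro allI impI tendstoI)
  interpret prob_space N by fact
  fix x e :: real assume e: "e > 0"
  obtain \<delta> where \<delta>: "\<delta> > 0" "\<And>y. \<bar>y - x\<bar> \<le> \<delta> \<Longrightarrow> \<bar>cdf \<mu> y - cdf \<mu> x\<bar> < e / 3"
  proof -
    obtain s where "s > 0" "\<And>y. \<bar>y - x\<bar> < s \<Longrightarrow> \<bar>cdf \<mu> y - cdf \<mu> x\<bar> < e / 3"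
      using cont[of x, unfolded continuous_at_eps_delta, rule_format, of "e / 3"] e
      by (auto simp: dist_real_def)
    \<comment> \<open>Halving makes the neighbourhood closed, so that the end points x + \<delta>
      and x - \<delta> are included.\<close>
    then show ?thesis by (intro that[of "s / 2"]) auto
  qed
  have cdf: "cdf (distr N borel U) y = measure N {\<omega>\<in>space N. U \<omega> \<le> y}" if "U \<in> borel_measurable N" for U y
    unfolding cdf_def using that by (subst measure_distr) (auto intro!: arg_cong[where f="measure N"])
  have up: "\<forall>\<^sub>F t in F. dist (cdf (distr N borel (X t)) y) (cdf \<mu> y) < e / 3" for y
    using conv cont[of y] e unfolding converges_in_distribution_def by (intro tendstoD) auto
  have small: "\<forall>\<^sub>F t in F. dist (LINT \<omega>|N. (X t \<omega> - Z t \<omega>)\<^sup>2) 0 < \<delta>\<^sup>2 * (e / 3)"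
    using lim e \<delta> by (intro tendstoD) auto
  show "\<forall>\<^sub>F t in F. dist (cdf (distr N borel (Z t)) x) (cdf \<mu> x) < e"
    using up[of "x + \<delta>"] up[of "x - \<delta>"] small int
  proof eventually_elim
    case (elim t)
    define p where "p = measure N {\<omega>\<in>space N. (X t \<omega> - Z t \<omega>)\<^sup>2 \<ge> \<delta>\<^sup>2}"
    have "p \<le> (LINT \<omega>|N. (X t \<omega> - Z t \<omega>)\<^sup>2) / \<delta>\<^sup>2"
      unfolding p_def using \<delta>(1) elim(4)
      by (intro integral_Markov_inequality_measure[where A="space N"]) auto
    also have "\<dots> < e / 3"
      using elim(3) \<delta>(1) by (simp add: dist_real_def field_simps)
    finally have p: "p < e / 3" .
    have sq: "\<bar>u\<bar> \<ge> \<delta> \<Longrightarrow> u\<^sup>2 \<ge> \<delta>\<^sup>2" for u using \<delta>(1) by (metis abs_le_square_iff abs_of_pos)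
    have "measure N {\<omega>\<in>space N. Z t \<omega> \<le> x}
        \<le> measure N ({\<omega>\<in>space N. X t \<omega> \<le> x + \<delta>} \<union> {\<omega>\<in>space N. (X t \<omega> - Z t \<omega>)\<^sup>2 \<ge> \<delta>\<^sup>2})"
      by (rule finite_measure_mono) (auto intro!: sq)
    also have "\<dots> \<le> measure N {\<omega>\<in>space N. X t \<omega> \<le> x + \<delta>} + p"
      unfolding p_def by (rule measure_Un_le) auto
    finally have 1: "cdf (distr N borel (Z t)) x \<le> cdf (distr N borel (X t)) (x + \<delta>) + p"
      by (simp add: cdf)
    have "measure N {\<omega>\<in>space N. X t \<omega> \<le> x - \<delta>}
        \<le> measure N ({\<omega>\<in>space N. Z t \<omega> \<le> x} \<union> {\<omega>\<in>space N. (X t \<omega> - Z t \<omega>)\<^sup>2 \<ge> \<delta>\<^sup>2})"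
      by (rule finite_measure_mono) (auto intro!: sq)
    also have "\<dots> \<le> measure N {\<omega>\<in>space N. Z t \<omega> \<le> x} + p"
      unfolding p_def by (rule measure_Un_le) auto
    finally have 2: "cdf (distr N borel (X t)) (x - \<delta>) \<le> cdf (distr N borel (Z t)) x + p"
      by (simp add: cdf)
    have "\<bar>cdf \<mu> (x + \<delta>) - cdf \<mu> x\<bar> < e / 3" "\<bar>cdf \<mu> (x - \<delta>) - cdf \<mu> x\<bar> < e / 3"
      using \<delta> by simp_all
    then show ?case
      using 1 2 p elim(1,2) unfolding dist_real_def abs_less_iff by (intro conjI; linarith)
  qed
qed

lemma isCont_cdf_std_normal: "isCont (cdf std_normal_distribution) x"
proof -
  interpret real_distribution std_normal_distribution by (rule real_dist_normal_dist)
  have "emeasure std_normal_distribution {x} = 0"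
    by (simp add: emeasure_density nn_integral_indicator_singleton)
  then have "measure std_normal_distribution {x} = 0" by (simp add: measure_def)
  then show ?thesis by (simp add: isCont_cdf)
qed

lemma standardize_centered:
  "integral\<^sup>L N P = 0 \<Longrightarrow> standardize N P \<omega> = P \<omega> / sqrt (LINT \<omega>|N. (P \<omega>)\<^sup>2)"
  by (simp add: standardize_def covariance_def power2_eq_square)

lemma standardize_scale:
  assumes "c > 0"
  shows "standardize N (\<lambda>\<omega>. c * P \<omega>) = standardize N P"
proof
  fix \<omega>
  have "covariance N (\<lambda>\<omega>. c * P \<omega>) (\<lambda>\<omega>. c * P \<omega>) = c\<^sup>2 * covariance N P P"
    unfolding covariance_def integral_mult_right_zero
    by (subst integral_mult_right_zero[symmetric]) (simp add: power2_eq_square algebra_simps)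
  then show "standardize N (\<lambda>\<omega>. c * P \<omega>) \<omega> = standardize N P \<omega>"
    using assms by (simp add: standardize_def real_sqrt_mult flip: right_diff_distrib)
qed

text \<open>Mean and variance are functions of the law, so both standardisations are the same affine
  map applied to equal laws, even on different probability spaces.\<close>

lemma standardize_distr:
  assumes [measurable]: "f \<in> borel_measurable M" "g \<in> borel_measurable N"
    and eq: "distr M borel f = distr N borel g"
  shows "distr M borel (standardize M f) = distr N borel (standardize N g)"
proof -
  have E: "(LINT \<omega>|M. h (f \<omega>)) = (LINT \<omega>|N. h (g \<omega>))" if [measurable]: "h \<in> borel_measurable borel" for h :: "real \<Rightarrow> real"
  proof -
    have "(LINT \<omega>|M. h (f \<omega>)) = (LINT x|distr M borel f. h x)" by (rule integral_distr[symmetric]) auto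
    also have "\<dots> = (LINT \<omega>|N. h (g \<omega>))" unfolding eq by (rule integral_distr) auto
    finally show ?thesis .
  qed
  have m: "integral\<^sup>L M f = integral\<^sup>L N g" using E[of "\<lambda>x. x"] by simp
  have v: "covariance M f f = covariance N g g"
    unfolding covariance_def m by (rule E) auto
  let ?s = "\<lambda>x. (x - integral\<^sup>L N g) / sqrt (covariance N g g)"
  have "distr M borel (standardize M f) = distr (distr M borel f) borel ?s"
    by (subst distr_distr) (auto simp: comp_def standardize_def[abs_def] m v)
  also have "\<dots> = distr N borel (standardize N g)"
    unfolding eq by (subst distr_distr) (auto simp: comp_def standardize_def[abs_def])
  finally show ?thesis .
qed

text \<open>With s, s' the standard deviations of P and P + R, the bound is the inequality
  2 - 2 E P (P + R) / (s s') = (E R^2 - (s - s')^2) / (s s').\<close>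

lemma standardize_perturbation:
  fixes P R :: "'w \<Rightarrow> real"
  assumes N: "prob_space N" and [measurable]: "P \<in> borel_measurable N" "R \<in> borel_measurable N"
    and int: "integrable N (\<lambda>\<omega>. (P \<omega>)\<^sup>2)" "integrable N (\<lambda>\<omega>. (R \<omega>)\<^sup>2)"
    and mean: "integral\<^sup>L N P = 0" "integral\<^sup>L N R = 0"
    and pos: "(LINT \<omega>|N. (P \<omega>)\<^sup>2) > 0" and small: "4 * (LINT \<omega>|N. (R \<omega>)\<^sup>2) \<le> (LINT \<omega>|N. (P \<omega>)\<^sup>2)"
  defines "\<Delta> \<equiv> \<lambda>\<omega>. standardize N P \<omega> - standardize N (\<lambda>\<omega>. P \<omega> + R \<omega>) \<omega>"
  shows "integrable N (\<lambda>\<omega>. (\<Delta> \<omega>)\<^sup>2)"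
    and "(LINT \<omega>|N. (\<Delta> \<omega>)\<^sup>2) \<le> 2 * (LINT \<omega>|N. (R \<omega>)\<^sup>2) / (LINT \<omega>|N. (P \<omega>)\<^sup>2)"
proof -
  interpret prob_space N by fact
  have i1: "integrable N P" "integrable N R"
    using integrable_mult_square[of P N "\<lambda>_. 1"] integrable_mult_square[of R N "\<lambda>_. 1"] int by simp_all
  have i2: "integrable N (\<lambda>\<omega>. P \<omega> * R \<omega>)" by (rule integrable_mult_square) (use int in auto)
  define p r c where "p = (LINT \<omega>|N. (P \<omega>)\<^sup>2)" and "r = (LINT \<omega>|N. (R \<omega>)\<^sup>2)" and "c = (LINT \<omega>|N. P \<omega> * R \<omega>)"
  have mQ: "integral\<^sup>L N (\<lambda>\<omega>. P \<omega> + R \<omega>) = 0" using i1 mean by simp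
  have comb: "integrable N (\<lambda>\<omega>. (a * P \<omega> + b * R \<omega>)\<^sup>2)"
    "(LINT \<omega>|N. (a * P \<omega> + b * R \<omega>)\<^sup>2) = a\<^sup>2 * p + b\<^sup>2 * r + 2 * a * b * c" for a b
  proof -
    have eq: "(a * P \<omega> + b * R \<omega>)\<^sup>2 = a\<^sup>2 * (P \<omega>)\<^sup>2 + b\<^sup>2 * (R \<omega>)\<^sup>2 + 2 * a * b * (P \<omega> * R \<omega>)" for \<omega>
      by (simp add: power2_eq_square algebra_simps)
    show "integrable N (\<lambda>\<omega>. (a * P \<omega> + b * R \<omega>)\<^sup>2)" unfolding eq using int i2 by simp
    show "(LINT \<omega>|N. (a * P \<omega> + b * R \<omega>)\<^sup>2) = a\<^sup>2 * p + b\<^sup>2 * r + 2 * a * b * c"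
      unfolding eq p_def r_def c_def using int i2 by simp
  qed
  define q where "q = p + r + 2 * c"
  have q: "(LINT \<omega>|N. (P \<omega> + R \<omega>)\<^sup>2) = q" using comb(2)[of 1 1] by (simp add: q_def)
  have r0: "r \<ge> 0" unfolding r_def by (intro Bochner_Integration.integral_nonneg) auto
  \<comment> \<open>The weight 2 gives 2c \<ge> -p/2 - 2r, hence q \<ge> p/2 - r; the factor 4 in
    the smallness assumption then leaves q \<ge> p/4.\<close>
  have "0 \<le> (LINT \<omega>|N. (1 * P \<omega> + 2 * R \<omega>)\<^sup>2)"
    by (intro Bochner_Integration.integral_nonneg) auto
  then have "p + 4 * r + 4 * c \<ge> 0" unfolding comb by simp
  then have q4: "q \<ge> p / 4" using small by (simp add: q_def p_def r_def)
  have p0: "p > 0" using pos by (simp add: p_def)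
  define s s' where "s = sqrt p" and "s' = sqrt q"
  have s: "s > 0" "s' > 0" "s\<^sup>2 = p" "s'\<^sup>2 = q" using p0 q4 by (auto simp: s_def s'_def)
  have "s / 2 \<le> s'" unfolding s_def s'_def using real_sqrt_le_mono[OF q4] by (simp add: real_sqrt_divide)
  \<comment> \<open>The origin of the factor 2 in the final bound.\<close>
  then have ss: "p / 2 \<le> s * s'" using s mult_left_mono[of "s / 2" s' s] by (simp add: power2_eq_square)
  have \<Delta>: "\<Delta> \<omega> = (1 / s - 1 / s') * P \<omega> + (- 1 / s') * R \<omega>" for \<omega>
    unfolding \<Delta>_def standardize_centered[OF mean(1)] standardize_centered[OF mQ] q s_def s'_def p_def
    by (simp add: algebra_simps add_divide_distrib)
  show "integrable N (\<lambda>\<omega>. (\<Delta> \<omega>)\<^sup>2)" unfolding \<Delta> by (rule comb)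
  have "(LINT \<omega>|N. (\<Delta> \<omega>)\<^sup>2) = (1 / s - 1 / s')\<^sup>2 * p + (- 1 / s')\<^sup>2 * r + 2 * (1 / s - 1 / s') * (- 1 / s') * c"
    unfolding \<Delta> by (rule comb)
  also have "\<dots> = (r - (s - s')\<^sup>2) / (s * s')"
  proof -
    \<comment> \<open>The mixed moment is eliminated through q, the second moment of P + R, leaving
      a bound free of correlations.\<close>
    have c: "c = (s'\<^sup>2 - s\<^sup>2 - r) / 2" using s by (simp add: q_def)
    show ?thesis unfolding c s(3)[symmetric] using s(1,2) by (simp add: field_simps power2_eq_square)
  qed
  also have "\<dots> \<le> r / (s * s')" using s by (intro divide_right_mono) auto
  also have "\<dots> \<le> r / (p / 2)" using ss p0 r0 by (intro divide_left_mono) (use s in auto)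
  finally show "(LINT \<omega>|N. (\<Delta> \<omega>)\<^sup>2) \<le> 2 * (LINT \<omega>|N. (R \<omega>)\<^sup>2) / (LINT \<omega>|N. (P \<omega>)\<^sup>2)"
    by (simp add: p_def r_def mult.commute)
qed

section \<open>The chaos expansion\<close>

text \<open>The second moment is the double integral of E H_k(U) H_k(V) = k! (K(x - y)/K(0))^k. Only
  compactness of the dilate is assumed, so that the formulas hold for every t.\<close>

lemma A_functional_moments:
  fixes X :: "'x::euclidean_space \<Rightarrow> 'w \<Rightarrow> real"
  assumes M: "prob_space M" and G: "gaussian_field M X" and cont: "continuous_field M X"
    and Z: "centered_field M X" and K: "has_covariance_function M X K" and pos: "K 0 > 0"
    and E: "compact (dilate t D)"
  shows "integrable M (A_functional X K D k t)"
    and "integrable M (\<lambda>\<omega>. (A_functional X K D k t \<omega>)\<^sup>2)"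
    and "k > 0 \<Longrightarrow> integral\<^sup>L M (A_functional X K D k t) = 0"
    and "(LINT \<omega>|M. (A_functional X K D k t \<omega>)\<^sup>2)
      = fact k / K 0 ^ k * ((measure lborel (dilate t D))\<^sup>2 * gamma_ratio K D k t)"
proof -
  let ?L = "restrict_space lborel (dilate t D)"
  note L = restrict_lborel_compact[OF E]
  note h = gaussian_field_hermite[OF M G Z K pos]
  note Kc = covariance_function_continuous[OF M G cont Z K]
  have [measurable]: "X x \<in> borel_measurable M" for x by (rule gaussian_field_second_moments(1)[OF M G Z K])
  have A: "A_functional X K D k t = (\<lambda>\<omega>. LINT x|?L. hermite k (X x \<omega> / sqrt (K 0)))"
    by (simp add: A_functional_def[abs_def] L(6))
  have [measurable]: "(\<lambda>z. X (fst z) (snd z)) \<in> borel_measurable (?L \<Otimes>\<^sub>M M)"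
    by (rule continuous_field_jointly_measurable[OF L(2) _ cont]) simp
  have c: "continuous_on UNIV (\<lambda>x. hermite k (X x \<omega> / sqrt (K 0)))" if "\<omega> \<in> space M" for \<omega>
    using cont that pos by (auto simp: continuous_field_def intro!: continuous_intros)
  have "(LINT \<omega>|M. (hermite k (X x \<omega> / sqrt (K 0)))\<^sup>2) = fact k" for x
    using h(4)[of k x x] pos by (simp add: power2_eq_square)
  then have im: "(LINT \<omega>|M. LINT x|?L. hermite k (X x \<omega> / sqrt (K 0))) = (LINT x|?L. LINT \<omega>|M. hermite k (X x \<omega> / sqrt (K 0)))"
    "integrable M (\<lambda>\<omega>. LINT x|?L. hermite k (X x \<omega> / sqrt (K 0)))"
    "integrable M (\<lambda>\<omega>. (LINT x|?L. hermite k (X x \<omega> / sqrt (K 0)))\<^sup>2)"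
    "(LINT \<omega>|M. (LINT x|?L. hermite k (X x \<omega> / sqrt (K 0)))\<^sup>2)
      = (LINT z|(?L \<Otimes>\<^sub>M ?L). LINT \<omega>|M. hermite k (X (fst z) \<omega> / sqrt (K 0)) * hermite k (X (snd z) \<omega> / sqrt (K 0)))"
    by (intro integral_moments[where Z="\<lambda>x \<omega>. hermite k (X x \<omega> / sqrt (K 0))" and c="fact k"] L(1) M h(2)
        integrable_continuous_bounded_space[OF L(1-3) c]; simp)+
  show "integrable M (A_functional X K D k t)" "integrable M (\<lambda>\<omega>. (A_functional X K D k t \<omega>)\<^sup>2)"
    unfolding A by (rule im)+
  show "integral\<^sup>L M (A_functional X K D k t) = 0" if "k > 0"
    unfolding A im(1) by (simp add: h(3)[OF that])
  have "(LINT \<omega>|M. (A_functional X K D k t \<omega>)\<^sup>2) = fact k / K 0 ^ k * (LINT z|(?L \<Otimes>\<^sub>M ?L). K (fst z - snd z) ^ k)"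
    unfolding A im(4) h(4) by (simp add: power_divide)
  also have "(LINT z|(?L \<Otimes>\<^sub>M ?L). K (fst z - snd z) ^ k) = (measure lborel (dilate t D))\<^sup>2 * gamma_ratio K D k t"
  \<comment> \<open>For a null domain \<open>gamma_ratio\<close> divides by 0 and cannot be
    cancelled against the volume; the double integral is then shown to vanish.\<close>
  proof (cases "measure lborel (dilate t D) = 0")
    case True
    interpret L: finite_measure ?L by (rule L)
    have "emeasure ?L (dilate t D) = 0"
      using True L(5) by (simp add: L.emeasure_eq_measure)
    then have "emeasure (?L \<Otimes>\<^sub>M ?L) (space (?L \<Otimes>\<^sub>M ?L)) = 0"
      using L.emeasure_pair_measure_Times[of "dilate t D" ?L "dilate t D"] sets.top[of ?L] L(4)
      by (simp add: space_pair_measure)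
    then have "AE z in ?L \<Otimes>\<^sub>M ?L. False" by (intro AE_I[of _ _ "space (?L \<Otimes>\<^sub>M ?L)"]) auto
    then have "(LINT z|(?L \<Otimes>\<^sub>M ?L). K (fst z - snd z) ^ k) = 0" by (intro integral_eq_zero_AE) auto
    then show ?thesis using True by simp
  next
    case False
    then show ?thesis unfolding gamma_ratio_eq[OF E Kc] by simp
  qed
  finally show "(LINT \<omega>|M. (A_functional X K D k t \<omega>)\<^sup>2)
      = fact k / K 0 ^ k * ((measure lborel (dilate t D))\<^sup>2 * gamma_ratio K D k t)" .
qed

lemma A_functional_0:
  assumes "compact (dilate t D)"
  shows "A_functional X K D 0 t \<omega> = measure lborel (dilate t D)"
  using restrict_lborel_compact(4,5)[OF assms]
  by (simp add: A_functional_def restrict_lborel_compact(6)[OF assms])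

text \<open>B has the finite-dimensional distributions of the sum of independent copies of B1 and B2;
  the Hermite addition formula then expands the integral over the box.\<close>

lemma Y_functional_law:
  fixes M :: "'w measure" and M1 :: "'u measure" and M2 :: "'v measure"
    and B :: "'x::euclidean_space \<times> 'y::euclidean_space \<Rightarrow> 'w \<Rightarrow> real"
  assumes M: "prob_space M" "gaussian_field M B" "continuous_field M B" "centered_field M B"
      "has_covariance_function M B C"
    and C0: "C 0 = 1" and sep: "\<And>x1 x2. C (x1, x2) = K1 x1 + K2 x2"
    and M1: "prob_space M1" "gaussian_field M1 B1" "continuous_field M1 B1" "centered_field M1 B1"
      "has_covariance_function M1 B1 K1"
    and M2: "prob_space M2" "gaussian_field M2 B2" "continuous_field M2 B2" "centered_field M2 B2"
      "has_covariance_function M2 B2 K2"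
    and K: "K1 0 > 0" "K2 0 > 0"
    and E: "compact (dilate t1 D1)" "compact (dilate t2 D2)"
  shows "distr M borel (Y_functional B D1 D2 q t1 t2) = distr (M1 \<Otimes>\<^sub>M M2) borel (\<lambda>\<omega>. \<Sum>k\<le>q.
      real (q choose k) * (sqrt (K1 0) ^ k * sqrt (K2 0) ^ (q - k))
        * (A_functional B1 K1 D1 k t1 (fst \<omega>) * A_functional B2 K2 D2 (q - k) t2 (snd \<omega>)))"
    and "Y_functional B D1 D2 q t1 t2 \<in> borel_measurable M"
proof -
  let ?E = "dilate t1 D1 \<times> dilate t2 D2"
  let ?L = "restrict_space lborel ?E" and ?L1 = "restrict_space lborel (dilate t1 D1)"
    and ?L2 = "restrict_space lborel (dilate t2 D2)" and ?N = "M1 \<Otimes>\<^sub>M M2"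
  interpret M1: prob_space M1 by fact
  interpret M2: prob_space M2 by fact
  interpret N: pair_prob_space M1 M2 ..
  note g = gaussian_field_second_moments[OF M(1,2,4,5)]
    and g1 = gaussian_field_second_moments[OF M1(1,2,4,5)]
    and g2 = gaussian_field_second_moments[OF M2(1,2,4,5)]
  note [measurable] = g(1) g1(1) g2(1)
  have cE: "compact ?E" using E by (rule compact_Times)
  note L = restrict_lborel_compact[OF cE] and L1 = restrict_lborel_compact[OF E(1)]
    and L2 = restrict_lborel_compact[OF E(2)]
  interpret L1: finite_measure ?L1 by (rule L1)
  interpret L2: finite_measure ?L2 by (rule L2)
  define B' where "B' x \<omega> = B1 (fst x) (fst \<omega>) + B2 (snd x) (snd \<omega>)" for x and \<omega> :: "'u \<times> 'v"
  have [measurable]: "B' x \<in> borel_measurable ?N" for x unfolding B'_def[abs_def] by measurable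
  have comp: "continuous_on UNIV (\<lambda>x. B1 (fst x) \<omega>1)" "continuous_on UNIV (\<lambda>x. B2 (snd x) \<omega>2)"
    if "\<omega>1 \<in> space M1" "\<omega>2 \<in> space M2" for \<omega>1 \<omega>2
    using M1(3) M2(3) that
    by (auto simp: continuous_field_def intro!: continuous_on_compose2[of UNIV "\<lambda>x. B1 x \<omega>1" UNIV fst]
        continuous_on_compose2[of UNIV "\<lambda>x. B2 x \<omega>2" UNIV snd] continuous_intros)
  have B'c: "continuous_field ?N B'"
    unfolding continuous_field_def B'_def by (auto simp: space_pair_measure intro!: continuous_on_add comp)
  have Y: "Y_functional B D1 D2 q t1 t2 = (\<lambda>\<omega>. LINT x|?L. hermite q (B x \<omega>))"
    by (simp add: Y_functional_def[abs_def] L(6))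
  have "distr M borel (Y_functional B D1 D2 q t1 t2) = distr ?N borel (\<lambda>\<omega>. LINT x|?L. hermite q (B' x \<omega>))"
    unfolding Y
  proof (rule distr_path_integral_eq[OF M(1) N.P.prob_space_axioms _ M(3) _ B'c _ L(1-3)])
    fix I :: "('x \<times> 'y) set" and a b assume I: "finite I"
    have "(LINT \<omega>|?N. cos ((\<Sum>i\<in>I. a i * B' i \<omega>) + b))
        = (LINT \<omega>|?N. cos ((\<Sum>i\<in>I. a i * B1 (fst i) (fst \<omega>)) + (\<Sum>i\<in>I. a i * B2 (snd i) (snd \<omega>)) + b))"
      by (simp add: B'_def sum.distrib distrib_left)
    also have "\<dots> = exp (- (\<Sum>i\<in>I. \<Sum>j\<in>I. a i * a j * K1 (fst i - fst j)) / 2)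
        * exp (- (\<Sum>i\<in>I. \<Sum>j\<in>I. a i * a j * K2 (snd i - snd j)) / 2) * cos b"
      by (rule integral_cos_pair[OF M1(1) M2(1) _ _ g1(6)[OF I, where f=fst] g2(6)[OF I, where f=snd]]) measurable
    \<comment> \<open>Additive separability enters here: adding independent fields adds their
      quadratic forms.\<close>
    also have "\<dots> = exp (- (\<Sum>i\<in>I. \<Sum>j\<in>I. a i * a j * C (i - j)) / 2) * cos b"
    proof -
      have "C (i - j) = K1 (fst i - fst j) + K2 (snd i - snd j)" for i j
        using sep[of "fst (i - j)" "snd (i - j)"] unfolding prod.collapse by simp
      then show ?thesis
        by (simp add: sum.distrib distrib_left diff_divide_distrib flip: exp_add)
    qed
    also have "\<dots> = (LINT \<omega>|M. cos ((\<Sum>i\<in>I. a i * B i \<omega>) + b))" by (rule g(6)[OF I, symmetric])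
    finally show "(LINT \<omega>|M. cos ((\<Sum>i\<in>I. a i * B i \<omega>) + b)) = (LINT \<omega>|?N. cos ((\<Sum>i\<in>I. a i * B' i \<omega>) + b))" ..
  qed (auto intro!: continuous_intros)
  also have "\<dots> = distr ?N borel (\<lambda>\<omega>. \<Sum>k\<le>q. real (q choose k) * (sqrt (K1 0) ^ k * sqrt (K2 0) ^ (q - k))
        * (A_functional B1 K1 D1 k t1 (fst \<omega>) * A_functional B2 K2 D2 (q - k) t2 (snd \<omega>)))"
  proof (rule distr_cong)
    fix \<omega> assume "\<omega> \<in> space ?N"
    then have \<omega>: "fst \<omega> \<in> space M1" "snd \<omega> \<in> space M2" by (auto simp: space_pair_measure)
    \<comment> \<open>Unit variance of B is exactly the condition on the coefficients in the Hermite
      addition formula, applied to B1 and B2 normalised to variance 1.\<close>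
    have one: "(sqrt (K1 0))\<^sup>2 + (sqrt (K2 0))\<^sup>2 = 1"
      using K sep[of 0 0] C0 by (simp add: zero_prod_def)
    define h1 where "h1 k x = hermite k (B1 x (fst \<omega>) / sqrt (K1 0))" for k x
    define h2 where "h2 k x = hermite k (B2 x (snd \<omega>) / sqrt (K2 0))" for k x
    have c12: "continuous_on UNIV (h1 k)" "continuous_on UNIV (h2 k)" for k
      using M1(3) M2(3) \<omega> K unfolding h1_def h2_def by (auto simp: continuous_field_def intro!: continuous_intros)
    have int: "integrable ?L1 (h1 k)" "integrable ?L2 (h2 k)" for k
      by (rule integrable_continuous_bounded_space[OF L1(1-3) c12(1)] integrable_continuous_bounded_space[OF L2(1-3) c12(2)])+
    note pp = integral_pair_product[OF L1.sigma_finite_measure_axioms L2.sigma_finite_measure_axioms int]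
    have "(LINT x|?L. hermite q (B' x \<omega>)) = (LINT x|(?L1 \<Otimes>\<^sub>M ?L2). hermite q (B' x \<omega>))"
      unfolding L(6)[symmetric] B'_def
      by (rule set_integral_Times_compact[OF E]) (intro continuous_on_hermite continuous_on_add comp(1)[OF \<omega>] comp(2)[OF \<omega>])
    also have "\<dots> = (LINT x|(?L1 \<Otimes>\<^sub>M ?L2). (\<Sum>k\<le>q. real (q choose k) * (sqrt (K1 0) ^ k * sqrt (K2 0) ^ (q - k))
        * (h1 k (fst x) * h2 (q - k) (snd x))))"
    proof (rule Bochner_Integration.integral_cong[OF refl])
      fix x :: "'x \<times> 'y"
      show "hermite q (B' x \<omega>) = (\<Sum>k\<le>q. real (q choose k) * (sqrt (K1 0) ^ k * sqrt (K2 0) ^ (q - k))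
        * (h1 k (fst x) * h2 (q - k) (snd x)))"
        using hermite_add[OF one, of q "B1 (fst x) (fst \<omega>) / sqrt (K1 0)" "B2 (snd x) (snd \<omega>) / sqrt (K2 0)"] K
        by (simp add: B'_def h1_def h2_def)
    qed
    also have "\<dots> = (\<Sum>k\<le>q. real (q choose k) * (sqrt (K1 0) ^ k * sqrt (K2 0) ^ (q - k))
        * (integral\<^sup>L ?L1 (h1 k) * integral\<^sup>L ?L2 (h2 (q - k))))"
      by (subst Bochner_Integration.integral_sum) (auto intro!: integrable_mult_right pp simp: pp)
    also have "\<dots> = (\<Sum>k\<le>q. real (q choose k) * (sqrt (K1 0) ^ k * sqrt (K2 0) ^ (q - k))
        * (A_functional B1 K1 D1 k t1 (fst \<omega>) * A_functional B2 K2 D2 (q - k) t2 (snd \<omega>)))"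
      unfolding A_functional_def L1(6) L2(6) h1_def h2_def ..
    finally show "(LINT x|?L. hermite q (B' x \<omega>)) = (\<Sum>k\<le>q. real (q choose k) * (sqrt (K1 0) ^ k * sqrt (K2 0) ^ (q - k))
        * (A_functional B1 K1 D1 k t1 (fst \<omega>) * A_functional B2 K2 D2 (q - k) t2 (snd \<omega>)))" .
  qed simp_all
  finally show "distr M borel (Y_functional B D1 D2 q t1 t2) = distr ?N borel (\<lambda>\<omega>. \<Sum>k\<le>q.
      real (q choose k) * (sqrt (K1 0) ^ k * sqrt (K2 0) ^ (q - k))
        * (A_functional B1 K1 D1 k t1 (fst \<omega>) * A_functional B2 K2 D2 (q - k) t2 (snd \<omega>)))" .
  interpret L: finite_measure ?L by (rule L)
  interpret M: prob_space M by fact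
  interpret S: pair_sigma_finite ?L M ..
  have [measurable]: "(\<lambda>z. B (fst z) (snd z)) \<in> borel_measurable (?L \<Otimes>\<^sub>M M)"
    by (rule continuous_field_jointly_measurable[OF L(2) _ M(3)]) simp
  show "Y_functional B D1 D2 q t1 t2 \<in> borel_measurable M"
    unfolding Y
  proof (rule L.borel_measurable_lebesgue_integral)
    show "(\<lambda>(\<omega>, x). hermite q (B x \<omega>)) \<in> borel_measurable (M \<Otimes>\<^sub>M ?L)"
      using measurable_compose[OF measurable_pair_swap', of "\<lambda>z. hermite q (B (fst z) (snd z))" ?L M borel]
      by (simp add: case_prod_beta')
  qed
qed

section \<open>Negligibility of the terms k > 0 and transfer of the limit law\<close>

lemma distr_pair_snd:
  assumes "prob_space M1" "prob_space M2" and [measurable]: "f \<in> borel_measurable M2"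
  shows "distr (M1 \<Otimes>\<^sub>M M2) borel (\<lambda>\<omega>. f (snd \<omega>)) = distr M2 borel f"
proof -
  interpret M1: prob_space M1 by fact
  interpret M2: prob_space M2 by fact
  interpret pair_prob_space M1 M2 ..
  show ?thesis
  proof (rule measure_eqI)
    fix A assume "A \<in> sets (distr (M1 \<Otimes>\<^sub>M M2) borel (\<lambda>\<omega>. f (snd \<omega>)))"
    then have [measurable]: "A \<in> sets borel" by simp
    have "(\<lambda>\<omega>. f (snd \<omega>)) -` A \<inter> space (M1 \<Otimes>\<^sub>M M2) = space M1 \<times> (f -` A \<inter> space M2)"
      by (auto simp: space_pair_measure)
    then show "emeasure (distr (M1 \<Otimes>\<^sub>M M2) borel (\<lambda>\<omega>. f (snd \<omega>))) A = emeasure (distr M2 borel f) A"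
      by (simp add: emeasure_distr M2.emeasure_pair_measure_Times M1.emeasure_space_1)
  qed simp
qed

theorem theorem18:
  fixes M :: "'w measure" and M1 :: "'u measure" and M2 :: "'v measure"
    and B :: "(real ^ 'm) \<times> (real ^ 'n) \<Rightarrow> 'w \<Rightarrow> real"
    and B1 :: "real ^ 'm \<Rightarrow> 'u \<Rightarrow> real"
    and B2 :: "real ^ 'n \<Rightarrow> 'v \<Rightarrow> real"
    and C :: "(real ^ 'm) \<times> (real ^ 'n) \<Rightarrow> real"
    and K1 :: "real ^ 'm \<Rightarrow> real" and K2 :: "real ^ 'n \<Rightarrow> real"
    and D1 :: "(real ^ 'm) set" and D2 :: "(real ^ 'n) set"
    and q :: nat
    and F :: "(real \<times> real) filter"
  assumes "prob_space M" "gaussian_field M B" "continuous_field M B"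
      "centered_field M B" "stationary_field M B"
      "has_covariance_function M B C"
    and unit_variance: "\<And>x. covariance M (B x) (B x) = 1"
    and separable: "\<And>x1 x2. C (x1, x2) = K1 x1 + K2 x2"
    and "prob_space M1" "gaussian_field M1 B1" "continuous_field M1 B1"
      "centered_field M1 B1" "stationary_field M1 B1"
      "has_covariance_function M1 B1 K1"
    and "prob_space M2" "gaussian_field M2 B2" "continuous_field M2 B2"
      "centered_field M2 B2" "stationary_field M2 B2"
      "has_covariance_function M2 B2 K2"
    and "K1 0 > 0" "K2 0 > 0"
    and "\<And>x. K1 x \<ge> 0" "\<And>x. K2 x \<ge> 0"
    and "compact D1" "measure lborel D1 > 0"
    and "compact D2" "measure lborel D2 > 0"
    and "q \<ge> 1"
    and "both_at_top F"
    and "((\<lambda>(t1, t2). gamma_ratio K1 D1 q t1 / gamma_ratio K2 D2 q t2) \<longlongrightarrow> 0) F"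
  shows "converges_in_distribution M2
           (\<lambda>t2. standardize M2 (A_functional B2 K2 D2 q t2)) std_normal_distribution at_top
     \<longleftrightarrow> converges_in_distribution M
           (\<lambda>(t1, t2). standardize M (Y_functional B D1 D2 q t1 t2)) std_normal_distribution F"
proof -
  interpret M1: prob_space M1 by fact
  interpret M2: prob_space M2 by fact
  interpret N: pair_prob_space M1 M2 ..
  let ?N = "M1 \<Otimes>\<^sub>M M2"
  note f1 = assms(9,10,11,12,14) and f2 = assms(15,16,17,18,20)
  have C0: "C 0 = 1" using unit_variance[of 0] assms(6)[unfolded has_covariance_function_def, rule_format, of 0 0]
    by (simp only: diff_self)
  have E: "compact (dilate t D1)" "compact (dilate t D2)" for t
    using assms(25,27) by (simp_all add: compact_scaling)
  note K1c = covariance_function_continuous[OF f1] and K2c = covariance_function_continuous[OF f2]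
  define V where "V t = measure lborel (dilate (fst t) D1) * measure lborel (dilate (snd t) D2)" for t
  define g1 g2 where "g1 k t = gamma_ratio K1 D1 k (fst t)" and "g2 k t = gamma_ratio K2 D2 k (snd t)"
    for k and t :: "real \<times> real"
  define A1 A2 where "A1 k t = A_functional B1 K1 D1 k (fst t)" and "A2 k t = A_functional B2 K2 D2 k (snd t)"
    for k and t :: "real \<times> real"
  have m1: "integrable M1 (A1 k t)" "integrable M1 (\<lambda>\<omega>. (A1 k t \<omega>)\<^sup>2)"
    "k > 0 \<Longrightarrow> integral\<^sup>L M1 (A1 k t) = 0"
    "(LINT \<omega>|M1. (A1 k t \<omega>)\<^sup>2) = fact k / K1 0 ^ k
      * ((measure lborel (dilate (fst t) D1))\<^sup>2 * g1 k t)" for k t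
    unfolding A1_def g1_def by (rule A_functional_moments[OF f1 assms(21) E(1)]; assumption?)+
  have m2: "integrable M2 (A2 k t)" "integrable M2 (\<lambda>\<omega>. (A2 k t \<omega>)\<^sup>2)"
    "k > 0 \<Longrightarrow> integral\<^sup>L M2 (A2 k t) = 0"
    "(LINT \<omega>|M2. (A2 k t \<omega>)\<^sup>2) = fact k / K2 0 ^ k
      * ((measure lborel (dilate (snd t) D2))\<^sup>2 * g2 k t)" for k t
    unfolding A2_def g2_def by (rule A_functional_moments[OF f2 assms(22) E(2)]; assumption?)+
  have [measurable]: "A1 k t \<in> borel_measurable M1" "A2 k t \<in> borel_measurable M2" for k t
    using m1(1)[of k t] m2(1)[of k t] by auto
  define c where "c k = real (q choose k) * (sqrt (K1 0) ^ k * sqrt (K2 0) ^ (q - k))" for k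
  define W where "W k t \<omega> = c k * (A1 k t (fst \<omega>) * A2 (q - k) t (snd \<omega>))" for k t and \<omega> :: "'u \<times> 'v"
  \<comment> \<open>What remains of the constants in the second moment of \<open>W k\<close> once
    the powers of \<open>K1 0\<close> and \<open>K2 0\<close> in \<open>(c k)\<^sup>2\<close> cancel
    those from normalising the fields.\<close>
  define w where "w k = (real (q choose k))\<^sup>2 * (fact k * fact (q - k))" for k
  define R where "R t \<omega> = (\<Sum>k=1..q. W k t \<omega>)" for t \<omega>
  have [measurable]: "W k t \<in> borel_measurable ?N" for k t unfolding W_def[abs_def] by measurable
  have [measurable]: "R t \<in> borel_measurable ?N" for t unfolding R_def[abs_def] by measurable
  have Wint: "integrable ?N (W k t)"
    and Wmean: "k \<le> q \<Longrightarrow> integral\<^sup>L ?N (W k t) = 0" for k t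
  proof -
    note pp = integral_pair_product[OF M1.sigma_finite_measure_axioms M2.sigma_finite_measure_axioms m1(1) m2(1)]
    show "integrable ?N (W k t)" unfolding W_def[abs_def] by (intro integrable_mult_right pp)
    assume "k \<le> q"
    \<comment> \<open>As q \<ge> 1, the degrees k and q - k are not both 0, so one of the
      independent factors is centered.\<close>
    then have "integral\<^sup>L M1 (A1 k t) = 0 \<or> integral\<^sup>L M2 (A2 (q - k) t) = 0"
      using m1(3)[of k t] m2(3)[of "q - k" t] assms(29) by (cases "k = 0") auto
    then show "integral\<^sup>L ?N (W k t) = 0" unfolding W_def[abs_def] by (auto simp: pp)
  qed
  have Wsq: "integrable ?N (\<lambda>\<omega>. (W k t \<omega>)\<^sup>2)"
    "(LINT \<omega>|?N. (W k t \<omega>)\<^sup>2) = w k * (V t)\<^sup>2 * (g1 k t * g2 (q - k) t)" for k t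
  proof -
    note pp = integral_pair_product[OF M1.sigma_finite_measure_axioms M2.sigma_finite_measure_axioms m1(2) m2(2)]
    have eq: "(W k t \<omega>)\<^sup>2 = (c k)\<^sup>2 * ((A1 k t (fst \<omega>))\<^sup>2 * (A2 (q - k) t (snd \<omega>))\<^sup>2)" for \<omega>
      by (simp add: W_def power_mult_distrib)
    show "integrable ?N (\<lambda>\<omega>. (W k t \<omega>)\<^sup>2)" unfolding eq by (intro integrable_mult_right pp)
    have "(c k)\<^sup>2 = (real (q choose k))\<^sup>2 * (K1 0 ^ k * K2 0 ^ (q - k))"
      using assms(21,22) by (simp add: c_def power_mult_distrib power_mult[symmetric] mult.commute[of _ 2])
         (simp add: power_mult)
    then show "(LINT \<omega>|?N. (W k t \<omega>)\<^sup>2) = w k * (V t)\<^sup>2 * (g1 k t * g2 (q - k) t)"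
      unfolding eq integral_mult_right_zero pp m1(4) m2(4)
      using assms(21,22) by (simp add: w_def V_def power_mult_distrib)
  qed
  \<comment> \<open>Cauchy-Schwarz avoids computing mixed moments of the terms and costs only a
    factor q.\<close>
  have Rsq_le: "(R t \<omega>)\<^sup>2 \<le> real q * (\<Sum>k=1..q. (W k t \<omega>)\<^sup>2)" for t \<omega>
    using sum_squared_le_sum_of_squares[of "\<lambda>k. W k t \<omega>" "{1..q}"] by (simp add: R_def mult.commute)
  have Rbd: "integrable ?N (\<lambda>\<omega>. real q * (\<Sum>k=1..q. (W k t \<omega>)\<^sup>2))" for t
    by (intro integrable_mult_right Bochner_Integration.integrable_sum Wsq)
  have Rint: "integrable ?N (\<lambda>\<omega>. (R t \<omega>)\<^sup>2)" for t
  proof (rule Bochner_Integration.integrable_bound[OF Rbd[of t]])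
    show "AE \<omega> in ?N. norm ((R t \<omega>)\<^sup>2) \<le> norm (real q * (\<Sum>k=1..q. (W k t \<omega>)\<^sup>2))"
    proof (rule AE_I2)
      fix \<omega>
      show "norm ((R t \<omega>)\<^sup>2) \<le> norm (real q * (\<Sum>k=1..q. (W k t \<omega>)\<^sup>2))"
        using order_trans[OF Rsq_le abs_ge_self] by simp
    qed
  qed simp
  have Rmean: "integral\<^sup>L ?N (R t) = 0" for t
    unfolding R_def[abs_def] by (subst Bochner_Integration.integral_sum) (auto intro!: Wint sum.neutral simp: Wmean)
  have R2: "(LINT \<omega>|?N. (R t \<omega>)\<^sup>2) \<le> real q * (\<Sum>k=1..q. w k * (V t)\<^sup>2 * (g1 k t * g2 (q - k) t))" for t
  proof -
    have "(LINT \<omega>|?N. (R t \<omega>)\<^sup>2) \<le> (LINT \<omega>|?N. real q * (\<Sum>k=1..q. (W k t \<omega>)\<^sup>2))"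
      by (rule integral_mono[OF Rint Rbd Rsq_le])
    also have "\<dots> = real q * (\<Sum>k=1..q. w k * (V t)\<^sup>2 * (g1 k t * g2 (q - k) t))"
      unfolding integral_mult_right_zero by (subst Bochner_Integration.integral_sum) (auto simp: Wsq)
    finally show ?thesis .
  qed
  \<comment> \<open>The 4 is the product of the two factors 2 from comparing power means of K1 and
    K2; \<open>fact q\<close> comes from the second moment of the term k = 0.\<close>
  define H where "H t = real q * (\<Sum>k=1..q. w k / fact q * (4 * root q (g1 q t / g2 q t) ^ k))" for t
  have key: "(LINT \<omega>|?N. (W 0 t \<omega>)\<^sup>2) > 0"
    "(LINT \<omega>|?N. (R t \<omega>)\<^sup>2) / (LINT \<omega>|?N. (W 0 t \<omega>)\<^sup>2) \<le> H t"
    if t: "fst t > 0" "snd t > 0" for t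
  proof -
    note d1 = dilate_compact(2)[OF assms(25,26) t(1)] and d2 = dilate_compact(2)[OF assms(27,28) t(2)]
    have V: "V t > 0" using d1 d2 by (simp add: V_def)
    have pos: "g1 k t > 0" "g2 k t > 0" for k
      unfolding g1_def g2_def by (rule gamma_ratio_pos[OF assms(25,26) t(1) K1c assms(21,23)]
        gamma_ratio_pos[OF assms(27,28) t(2) K2c assms(22,24)])+
    \<comment> \<open>The functional of degree 0 is the volume itself; comparing its square with the
      general moment formula yields gamma1[0] = 1.\<close>
    have "(measure lborel (dilate (fst t) D1))\<^sup>2 = (measure lborel (dilate (fst t) D1))\<^sup>2 * g1 0 t"
      using m1(4)[of 0 t] unfolding A1_def A_functional_0[OF E(1)] by (simp add: M1.prob_space)
    then have g0: "g1 0 t = 1" using d1 by simp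
    have W0: "(LINT \<omega>|?N. (W 0 t \<omega>)\<^sup>2) = fact q * (V t)\<^sup>2 * g2 q t"
      by (simp add: Wsq g0 w_def)
    show "(LINT \<omega>|?N. (W 0 t \<omega>)\<^sup>2) > 0" unfolding W0 using V pos by simp
    define a b where "a = root q (g1 q t)" and "b = root q (g2 q t)"
    have q: "q > 0" using assms(29) by simp
    have b: "b > 0" "b ^ q = g2 q t" and a: "a \<ge> 0"
      using pos q by (auto simp: a_def b_def less_imp_le)
    have "(LINT \<omega>|?N. (R t \<omega>)\<^sup>2) / (LINT \<omega>|?N. (W 0 t \<omega>)\<^sup>2)
        \<le> (real q * (\<Sum>k=1..q. w k * (V t)\<^sup>2 * (g1 k t * g2 (q - k) t))) / (fact q * (V t)\<^sup>2 * g2 q t)"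
      unfolding W0 using R2 V pos by (intro divide_right_mono) (auto simp: less_imp_le)
    also have "\<dots> = real q * (\<Sum>k=1..q. w k * (V t)\<^sup>2 * (g1 k t * g2 (q - k) t) / (fact q * (V t)\<^sup>2 * g2 q t))"
      by (simp only: times_divide_eq_right sum_divide_distrib[symmetric])
    also have "\<dots> = real q * (\<Sum>k=1..q. w k / fact q * (g1 k t * g2 (q - k) t / g2 q t))"
      using V by (intro arg_cong2[where f="(*)"] sum.cong) simp_all
    also have "\<dots> \<le> H t"
      unfolding H_def
    proof (intro mult_left_mono sum_mono)
      fix k assume k: "k \<in> {1..q}"
      have "g1 k t * g2 (q - k) t \<le> (2 * a ^ k) * (2 * b ^ (q - k))"
      proof (rule mult_mono)
        show "g1 k t \<le> 2 * a ^ k" unfolding g1_def a_def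
          using k q by (intro gamma_ratio_le[OF assms(25,26) t(1) K1c assms(21,23)]) auto
        show "g2 (q - k) t \<le> 2 * b ^ (q - k)" unfolding g2_def b_def
          using k q by (intro gamma_ratio_le[OF assms(27,28) t(2) K2c assms(22,24)]) auto
      qed (use a b pos in \<open>auto simp: less_imp_le\<close>)
      then have "g1 k t * g2 (q - k) t / g2 q t \<le> (2 * a ^ k) * (2 * b ^ (q - k)) / b ^ q"
        unfolding b(2)[symmetric] using b(1) by (intro divide_right_mono) auto
      also have "\<dots> = 4 * (a / b) ^ k"
      proof -
        have "b ^ q = b ^ k * b ^ (q - k)" using k by (simp flip: power_add)
        then show ?thesis using b(1) by (simp add: power_divide)
      qed
      also have "a / b = root q (g1 q t / g2 q t)" by (simp add: a_def b_def real_root_divide)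
      finally show "g1 k t * g2 (q - k) t / g2 q t \<le> 4 * root q (g1 q t / g2 q t) ^ k" .
    qed (auto simp: w_def)
    finally show "(LINT \<omega>|?N. (R t \<omega>)\<^sup>2) / (LINT \<omega>|?N. (W 0 t \<omega>)\<^sup>2) \<le> H t" .
  qed
  \<comment> \<open>Equality of filters, rather than one inclusion, is what lets convergence along F
    return the unrestricted limit in t2.\<close>
  have snd_F: "filtermap snd F = at_top" using assms(30) by (simp add: both_at_top_def)
  have ev: "\<forall>\<^sub>F t in F. fst t > 0" "\<forall>\<^sub>F t in F. snd t > 0"
  proof -
    have "filterlim fst at_top F" "filterlim snd at_top F"
      using assms(30) by (auto simp: both_at_top_def filterlim_def)
    then show "\<forall>\<^sub>F t in F. fst t > 0" "\<forall>\<^sub>F t in F. snd t > 0"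
      by (simp_all add: filterlim_at_top_dense)
  qed
  have H0: "(H \<longlongrightarrow> 0) F"
  proof -
    have "((\<lambda>t. root q (g1 q t / g2 q t)) \<longlongrightarrow> root q 0) F"
      using assms(31) by (intro tendsto_real_root) (simp add: g1_def g2_def case_prod_beta')
    then have "((\<lambda>t. root q (g1 q t / g2 q t) ^ k) \<longlongrightarrow> 0 ^ k) F" for k
      by (intro tendsto_power) simp
    then have "(H \<longlongrightarrow> real q * (\<Sum>k=1..q. w k / fact q * (4 * 0 ^ k))) F"
      unfolding H_def[abs_def] by (intro tendsto_mult_left tendsto_sum)
    \<comment> \<open>The sum starts at 1, so every power of 0 in it vanishes.\<close>
    moreover have "(\<Sum>k=1..q. w k / fact q * (4 * 0 ^ k)) = 0" by (intro sum.neutral) auto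
    ultimately show ?thesis by simp
  qed
  define X Z where "X t = standardize ?N (W 0 t)" and "Z t = standardize ?N (\<lambda>\<omega>. W 0 t \<omega> + R t \<omega>)" for t
  have [measurable]: "X t \<in> borel_measurable ?N" "Z t \<in> borel_measurable ?N" for t
    unfolding X_def Z_def standardize_def[abs_def] by measurable
  \<comment> \<open>The threshold 1/4 is the smallness that \<open>standardize_perturbation\<close>
    demands of the remainder.\<close>
  have H_small: "\<forall>\<^sub>F t in F. H t < 1 / 4" by (rule order_tendstoD(2)[OF H0]) simp
  have close: "\<forall>\<^sub>F t in F. integrable ?N (\<lambda>\<omega>. (X t \<omega> - Z t \<omega>)\<^sup>2) \<and> (LINT \<omega>|?N. (X t \<omega> - Z t \<omega>)\<^sup>2) \<le> 2 * H t"
    using ev H_small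
  proof eventually_elim
    case (elim t)
    note k = key[OF elim(1,2)]
    have small: "4 * (LINT \<omega>|?N. (R t \<omega>)\<^sup>2) \<le> (LINT \<omega>|?N. (W 0 t \<omega>)\<^sup>2)"
      using order.strict_trans1[OF k(2) elim(3)] k(1) by (simp add: divide_less_eq)
    note sp = standardize_perturbation[OF N.P.prob_space_axioms _ _ Wsq(1) Rint Wmean[OF le0] Rmean k(1) small, folded X_def Z_def]
    show ?case using sp(1) order_trans[OF sp(2)] k(2) by simp
  qed
  have lim: "((\<lambda>t. LINT \<omega>|?N. (X t \<omega> - Z t \<omega>)\<^sup>2) \<longlongrightarrow> 0) F"
  proof (rule tendsto_sandwich[of "\<lambda>_. 0" _ _ "\<lambda>t. 2 * H t"])
    show "\<forall>\<^sub>F t in F. (LINT \<omega>|?N. (X t \<omega> - Z t \<omega>)\<^sup>2) \<le> 2 * H t" using close by eventually_elim simp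
    show "((\<lambda>t. 2 * H t) \<longlongrightarrow> 0) F" using tendsto_mult_left[OF H0, of 2] by simp
  qed (auto intro!: always_eventually Bochner_Integration.integral_nonneg)
  have int: "\<forall>\<^sub>F t in F. integrable ?N (\<lambda>\<omega>. (X t \<omega> - Z t \<omega>)\<^sup>2)" using close by eventually_elim simp
  \<comment> \<open>The L2 distance is symmetric in X and Z, so the perturbation lemma is used once
    in each direction.\<close>
  have XZ: "converges_in_distribution ?N X std_normal_distribution F \<longleftrightarrow> converges_in_distribution ?N Z std_normal_distribution F"
    using converges_in_distribution_L2_close[OF N.P.prob_space_axioms isCont_cdf_std_normal, of X Z F]
      converges_in_distribution_L2_close[OF N.P.prob_space_axioms isCont_cdf_std_normal, of Z X F] int lim
    by (auto simp: power2_commute)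
  \<comment> \<open>The degree-0 factor is the volume of t1 D1, so \<open>W 0 t\<close> is a
    positive deterministic multiple of A2[q]; standardising cancels it and with it the dependence on
    t1.\<close>
  have lawX: "distr ?N borel (X t) = distr M2 borel (standardize M2 (A_functional B2 K2 D2 q (snd t)))"
    if t: "fst t > 0" for t
  proof -
    have "c 0 * measure lborel (dilate (fst t) D1) > 0"
      using dilate_compact(2)[OF assms(25,26) t] assms(22) by (simp add: c_def)
    then have "X t = standardize ?N (\<lambda>\<omega>. A2 q t (snd \<omega>))"
      unfolding X_def W_def[abs_def] A1_def A_functional_0[OF E(1)]
      using standardize_scale[of "c 0 * measure lborel (dilate (fst t) D1)" ?N "\<lambda>\<omega>. A2 q t (snd \<omega>)"]
      by (simp add: mult.assoc)
    moreover have "distr ?N borel (standardize ?N (\<lambda>\<omega>. A2 q t (snd \<omega>))) = distr M2 borel (standardize M2 (A2 q t))"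
      by (rule standardize_distr[OF _ _ distr_pair_snd[OF f1(1) f2(1)]]) measurable
    ultimately show ?thesis by (simp add: A2_def)
  qed
  have lawZ: "distr M borel (standardize M (Y_functional B D1 D2 q (fst t) (snd t))) = distr ?N borel (Z t)" for t
  proof -
    note Yl = Y_functional_law[OF assms(1,2,3,4,6) C0 separable f1 f2 assms(21,22) E, of q "fst t" "snd t"]
    have "{..q} = insert 0 {1..q}" by auto
    then have sum: "W 0 t \<omega> + R t \<omega> = (\<Sum>k\<le>q. W k t \<omega>)" for \<omega> by (simp add: R_def)
    have "distr M borel (Y_functional B D1 D2 q (fst t) (snd t)) = distr ?N borel (\<lambda>\<omega>. W 0 t \<omega> + R t \<omega>)"
      unfolding sum unfolding W_def c_def A1_def A2_def by (rule Yl(1))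
    then show ?thesis
      unfolding Z_def by (rule standardize_distr[OF Yl(2), rotated]) measurable
  qed
  have "converges_in_distribution M2 (\<lambda>t2. standardize M2 (A_functional B2 K2 D2 q t2)) std_normal_distribution at_top
      \<longleftrightarrow> converges_in_distribution ?N X std_normal_distribution F"
  proof -
    have "((\<lambda>t2. cdf (distr M2 borel (standardize M2 (A_functional B2 K2 D2 q t2))) x) \<longlongrightarrow> l) at_top
        \<longleftrightarrow> ((\<lambda>t. cdf (distr ?N borel (X t)) x) \<longlongrightarrow> l) F" for x l
    proof -
      \<comment> \<open>A function of the second coordinate converges along F exactly when it
        converges along the image of F under \<open>snd\<close>, which is all of
        \<open>at_top\<close>.\<close>
      have "((\<lambda>t2. cdf (distr M2 borel (standardize M2 (A_functional B2 K2 D2 q t2))) x) \<longlongrightarrow> l) at_top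
          \<longleftrightarrow> ((\<lambda>t. cdf (distr M2 borel (standardize M2 (A_functional B2 K2 D2 q (snd t)))) x) \<longlongrightarrow> l) F"
        unfolding snd_F[symmetric] by (simp add: filterlim_filtermap)
      also have "\<dots> \<longleftrightarrow> ((\<lambda>t. cdf (distr ?N borel (X t)) x) \<longlongrightarrow> l) F"
        by (rule tendsto_cong) (use ev(1) in eventually_elim, simp add: lawX)
      finally show ?thesis .
    qed
    then show ?thesis by (simp add: converges_in_distribution_def)
  qed
  also note XZ
  also have "converges_in_distribution ?N Z std_normal_distribution F
      \<longleftrightarrow> converges_in_distribution M (\<lambda>(t1, t2). standardize M (Y_functional B D1 D2 q t1 t2)) std_normal_distribution F"
    by (simp add: converges_in_distribution_def case_prod_beta' lawZ)
  finally show ?thesis .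
qed

end
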